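(* Let $f=c_dX^d+c_{d+1}X^{d+1}+\dots+c_nX^n\in\mathbb{Z}[X]$ with $d\le n$ and $c_dc_n\ne 0$. Let $k$ be the number of primes dividing $c_dc_n$. Let $M$ be the set of positive integers $m$ such that $f$ defines a unit on order $m$. If $f$ does not define generic units then $$|M|\le 3\cdot 7^{(n-d)(1+2k)}.$$
   Context: For a group $G$, $\mathbb{Z}G$ denotes the integral group ring. For $x\in G$ and $f\in\mathbb{Z}[X]$, $f(x)\in\mathbb{Z}G$ is the element obtained by evaluating $f$ at $x$. If $x\in G$ has finite order $m$, whether $f(x)$ is a unit of $\mathbb{Z}G$ depends only on $m$ (and $f$); when it is a unit, $f$ is said to define a unit on order $m$ (equivalently, the class of $f$ is a unit in $\mathbb{Z}[X]/(X^m-1)$). The polynomial $f$ defines generic units if there is a positive integer $D$ such that $f$ defines a unit on every order (positive integer) coprime with $D$. *)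

theory Defs
  imports "HOL-Algebra.Multiplicative_Group" "HOL-Algebra.Elementary_Groups"
    "HOL-Library.Poly_Mapping" "HOL-Computational_Algebra.Polynomial"
    "HOL-Computational_Algebra.Primes"
begin

text \<open>The integral group ring of \<open>G\<close>: finitely supported integer-valued functions on the
  carrier, where \<open>frag_of g\<close> is the basis element of \<open>g\<close>. The product is the bilinear extension of
  \<open>frag_of g * frag_of h = frag_of (g h)\<close>.\<close>

definition group_ring :: "('g, 'b) monoid_scheme \<Rightarrow> ('g \<Rightarrow>\<^sub>0 int) ring" where
  "group_ring G =
     \<lparr>carrier = {u. Poly_Mapping.keys u \<subseteq> carrier G},
      monoid.mult = (\<lambda>u v. frag_extend (\<lambda>g. frag_extend (\<lambda>h. frag_of (g \<otimes>\<^bsub>G\<^esub> h)) v) u),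
      one = frag_of \<one>\<^bsub>G\<^esub>,
      zero = 0,
      add = (+)\<rparr>"

definition eval_at :: "('g, 'b) monoid_scheme \<Rightarrow> 'g \<Rightarrow> int poly \<Rightarrow> ('g \<Rightarrow>\<^sub>0 int)" where
  "eval_at G x f = (\<Sum>i\<le>degree f. frag_cmul (Polynomial.coeff f i) (frag_of (x [^]\<^bsub>G\<^esub> i)))"

text \<open>For \<open>m > 0\<close>, the residue of 1 is an element of order \<open>m\<close> in the cyclic group of integers
  modulo \<open>m\<close>. (It is written \<open>1 mod m\<close> because it is 0 when \<open>m = 1\<close>.) That every other element of
  order \<open>m\<close>, in any group, gives the same condition is the lemma
  \<open>defines_unit_on_order_iff\<close> below.\<close>

definition defines_unit_on_order :: "int poly \<Rightarrow> nat \<Rightarrow> bool" where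
  "defines_unit_on_order f m \<longleftrightarrow>
     eval_at (integer_mod_group m) (1 mod int m) f \<in> Units (group_ring (integer_mod_group m))"

definition defines_generic_units :: "int poly \<Rightarrow> bool" where
  "defines_generic_units f \<longleftrightarrow>
     (\<exists>D::nat. D > 0 \<and> (\<forall>m::nat. m > 0 \<longrightarrow> coprime m D \<longrightarrow> defines_unit_on_order f m))"


lemma carrier_group_ring: "u \<in> carrier (group_ring G) \<longleftrightarrow> Poly_Mapping.keys u \<subseteq> carrier G"
  and one_group_ring: "\<one>\<^bsub>group_ring G\<^esub> = frag_of \<one>\<^bsub>G\<^esub>"
  and zero_group_ring: "\<zero>\<^bsub>group_ring G\<^esub> = 0"
  and add_group_ring: "u \<oplus>\<^bsub>group_ring G\<^esub> v = u + v"
  and mult_group_ring: "u \<otimes>\<^bsub>group_ring G\<^esub> v =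
    frag_extend (\<lambda>g. frag_extend (\<lambda>h. frag_of (g \<otimes>\<^bsub>G\<^esub> h)) v) u"
  by (simp_all add: group_ring_def)

lemma frag_extend_fun_diff: "frag_extend (\<lambda>g. a g - b g :: 'b \<Rightarrow>\<^sub>0 int) u = frag_extend a u - frag_extend b u"
proof -
  have "frag_cmul k (p - q) = frag_cmul k p - frag_cmul k q" for k and p q :: "'b \<Rightarrow>\<^sub>0 int"
    by (rule poly_mapping_eqI) (simp add: lookup_minus right_diff_distrib)
  then show ?thesis by (simp add: frag_extend_def sum_subtractf)
qed

lemma group_ring_mult_0:
  "0 \<otimes>\<^bsub>group_ring G\<^esub> v = 0" "u \<otimes>\<^bsub>group_ring G\<^esub> 0 = 0"
  by (simp_all add: mult_group_ring frag_extend_eq_0)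

lemma group_ring_mult_diff:
  "(u - u') \<otimes>\<^bsub>group_ring G\<^esub> v = u \<otimes>\<^bsub>group_ring G\<^esub> v - u' \<otimes>\<^bsub>group_ring G\<^esub> v"
  "u \<otimes>\<^bsub>group_ring G\<^esub> (v - v') = u \<otimes>\<^bsub>group_ring G\<^esub> v - u \<otimes>\<^bsub>group_ring G\<^esub> v'"
  by (simp_all add: mult_group_ring frag_extend_diff frag_extend_fun_diff)

lemma group_ring_mult_add:
  "(u + u') \<otimes>\<^bsub>group_ring G\<^esub> v = u \<otimes>\<^bsub>group_ring G\<^esub> v + u' \<otimes>\<^bsub>group_ring G\<^esub> v"
  "u \<otimes>\<^bsub>group_ring G\<^esub> (v + v') = u \<otimes>\<^bsub>group_ring G\<^esub> v + u \<otimes>\<^bsub>group_ring G\<^esub> v'"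
proof -
  show "(u + u') \<otimes>\<^bsub>group_ring G\<^esub> v = u \<otimes>\<^bsub>group_ring G\<^esub> v + u' \<otimes>\<^bsub>group_ring G\<^esub> v"
    using group_ring_mult_diff(1)[where u = "u + u'" and u' = u' and v = v and G = G] by simp
  show "u \<otimes>\<^bsub>group_ring G\<^esub> (v + v') = u \<otimes>\<^bsub>group_ring G\<^esub> v + u \<otimes>\<^bsub>group_ring G\<^esub> v'"
    using group_ring_mult_diff(2)[where u = u and v = "v + v'" and v' = v' and G = G] by simp
qed

lemma group_ring_mult_frag_of:
  "frag_of g \<otimes>\<^bsub>group_ring G\<^esub> frag_of h = frag_of (g \<otimes>\<^bsub>G\<^esub> h)"
  by (simp add: mult_group_ring)

lemma diff_in_carrier_group_ring:
  "u \<in> carrier (group_ring G) \<Longrightarrow> v \<in> carrier (group_ring G) \<Longrightarrow> u - v \<in> carrier (group_ring G)"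
  using keys_diff[of u v] by (auto simp: carrier_group_ring)

lemma frag_of_in_carrier_group_ring:
  "frag_of g \<in> carrier (group_ring G) \<longleftrightarrow> g \<in> carrier G"
  by (simp add: carrier_group_ring)

lemma group_ring_induct [consumes 1, case_names zero one diff]:
  assumes "u \<in> carrier (group_ring G)" "P 0" "\<And>g. g \<in> carrier G \<Longrightarrow> P (frag_of g)"
    "\<And>a b. a \<in> carrier (group_ring G) \<Longrightarrow> b \<in> carrier (group_ring G) \<Longrightarrow> P a \<Longrightarrow> P b \<Longrightarrow> P (a - b)"
  shows "P u"
proof -
  have "P u \<and> u \<in> carrier (group_ring G)"
    using assms(1)[unfolded carrier_group_ring]
  proof (induction u rule: frag_induction)
    case zero
    then show ?case using assms(2) by (simp add: carrier_group_ring)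
  next
    case (one x)
    then show ?case using assms(3) by (simp add: frag_of_in_carrier_group_ring)
  next
    case (diff a b)
    then show ?case using assms(4) diff_in_carrier_group_ring by blast
  qed
  then show ?thesis ..
qed

lemma (in group) group_ring_mult_closed:
  assumes "u \<in> carrier (group_ring G)" "v \<in> carrier (group_ring G)"
  shows "u \<otimes>\<^bsub>group_ring G\<^esub> v \<in> carrier (group_ring G)"
  using assms(1)
proof (induction u rule: group_ring_induct)
  case (one g)
  show ?case using assms(2)
  proof (induction v rule: group_ring_induct)
    case (one h)
    then show ?case using \<open>g \<in> carrier G\<close>
      by (simp add: group_ring_mult_frag_of frag_of_in_carrier_group_ring)
  qed (auto simp: group_ring_mult_diff group_ring_mult_0 diff_in_carrier_group_ring carrier_group_ring[of 0])
qed (auto simp: group_ring_mult_diff group_ring_mult_0 diff_in_carrier_group_ring carrier_group_ring[of 0])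

lemma (in group) group_ring_mult_assoc:
  assumes "u \<in> carrier (group_ring G)" "v \<in> carrier (group_ring G)" "w \<in> carrier (group_ring G)"
  shows "(u \<otimes>\<^bsub>group_ring G\<^esub> v) \<otimes>\<^bsub>group_ring G\<^esub> w = u \<otimes>\<^bsub>group_ring G\<^esub> (v \<otimes>\<^bsub>group_ring G\<^esub> w)"
  using assms(1)
proof (induction u rule: group_ring_induct)
  case (one g)
  note g = one
  show ?case using assms(2)
  proof (induction v rule: group_ring_induct)
    case (one h)
    note h = one
    show ?case using assms(3)
    proof (induction w rule: group_ring_induct)
      case (one k)
      then show ?case using g h by (simp add: group_ring_mult_frag_of m_assoc)
    qed (auto simp: group_ring_mult_diff group_ring_mult_0)
  qed (auto simp: group_ring_mult_diff group_ring_mult_0)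
qed (auto simp: group_ring_mult_diff group_ring_mult_0)

lemma (in group) group_ring_mult_one:
  assumes "u \<in> carrier (group_ring G)"
  shows "u \<otimes>\<^bsub>group_ring G\<^esub> frag_of \<one> = u" "frag_of \<one> \<otimes>\<^bsub>group_ring G\<^esub> u = u"
  using assms
  by (induction u rule: group_ring_induct)
     (auto simp: group_ring_mult_diff group_ring_mult_0 group_ring_mult_frag_of)

lemma (in group) ring_group_ring: "ring (group_ring G)"
proof (rule ringI)
  show "abelian_group (group_ring G)"
  proof (rule abelian_groupI)
    fix u v assume uv: "u \<in> carrier (group_ring G)" "v \<in> carrier (group_ring G)"
    show "u \<oplus>\<^bsub>group_ring G\<^esub> v \<in> carrier (group_ring G)"
      using uv keys_add[of u v] by (auto simp: carrier_group_ring add_group_ring)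
  next
    fix u assume u: "u \<in> carrier (group_ring G)"
    show "\<exists>v\<in>carrier (group_ring G). v \<oplus>\<^bsub>group_ring G\<^esub> u = \<zero>\<^bsub>group_ring G\<^esub>"
      using u by (intro bexI[of _ "- u"]) (auto simp: carrier_group_ring add_group_ring zero_group_ring)
  qed (auto simp: carrier_group_ring add_group_ring zero_group_ring algebra_simps)
  show "Group.monoid (group_ring G)"
    by (rule monoidI)
       (auto simp: group_ring_mult_closed group_ring_mult_assoc group_ring_mult_one
          one_group_ring frag_of_in_carrier_group_ring)
qed (auto simp: add_group_ring group_ring_mult_add)

lemma eval_at_upper:
  assumes "degree f \<le> n"
  shows "eval_at G x f = (\<Sum>i\<le>n. frag_cmul (Polynomial.coeff f i) (frag_of (x [^]\<^bsub>G\<^esub> i)))"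
  unfolding eval_at_def using assms
  by (intro sum.mono_neutral_left) (auto simp: coeff_eq_0)

lemma eval_at_0 [simp]: "eval_at G x 0 = 0"
  by (simp add: eval_at_def)

lemma eval_at_diff: "eval_at G x (f - g) = eval_at G x f - eval_at G x g"
  using eval_at_upper[of f "max (degree f) (degree g)" G x]
    eval_at_upper[of g "max (degree f) (degree g)" G x]
    eval_at_upper[of "f - g" "max (degree f) (degree g)" G x]
  by (simp add: degree_diff_le frag_cmul_diff_distrib sum_subtractf)

lemma eval_at_add: "eval_at G x (f + g) = eval_at G x f + eval_at G x g"
  using eval_at_diff[of G x "f + g" g] by simp

lemma eval_at_monom: "eval_at G x (Polynomial.monom c i) = frag_cmul c (frag_of (x [^]\<^bsub>G\<^esub> i))"
proof -
  have "eval_at G x (Polynomial.monom c i) =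
      (\<Sum>j\<le>i. if i = j then frag_cmul c (frag_of (x [^]\<^bsub>G\<^esub> j)) else 0)"
    unfolding eval_at_upper[OF degree_monom_le] by (rule sum.cong) auto
  then show ?thesis by simp
qed

lemma eval_at_1 [simp]: "eval_at G x 1 = frag_of \<one>\<^bsub>G\<^esub>"
  by (simp add: eval_at_def)

lemma (in group) eval_at_closed:
  assumes "x \<in> carrier G"
  shows "eval_at G x f \<in> carrier (group_ring G)"
proof -
  have "Poly_Mapping.keys (eval_at G x f) \<subseteq>
      (\<Union>i\<le>degree f. Poly_Mapping.keys (frag_cmul (Polynomial.coeff f i) (frag_of (x [^] i))))"
    unfolding eval_at_def by (rule keys_sum)
  also have "\<dots> \<subseteq> carrier G" using assms by (auto simp: keys_frag_of split: if_splits)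
  finally show ?thesis by (simp add: carrier_group_ring)
qed

lemma group_ring_mult_cmul:
  "frag_cmul c u \<otimes>\<^bsub>group_ring G\<^esub> v = frag_cmul c (u \<otimes>\<^bsub>group_ring G\<^esub> v)"
  "u \<otimes>\<^bsub>group_ring G\<^esub> frag_cmul c v = frag_cmul c (u \<otimes>\<^bsub>group_ring G\<^esub> v)"
proof -
  show "frag_cmul c u \<otimes>\<^bsub>group_ring G\<^esub> v = frag_cmul c (u \<otimes>\<^bsub>group_ring G\<^esub> v)"
    by (simp add: mult_group_ring frag_extend_cmul)
  show "u \<otimes>\<^bsub>group_ring G\<^esub> frag_cmul c v = frag_cmul c (u \<otimes>\<^bsub>group_ring G\<^esub> v)"
    by (simp add: mult_group_ring frag_extend_cmul) (simp add: frag_extend_def frag_cmul_sum ac_simps)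
qed

lemma poly_monom_induct [case_names monom add]:
  fixes p :: "'a :: comm_monoid_add poly"
  assumes "\<And>a i. P (Polynomial.monom a i)" "\<And>p q. P p \<Longrightarrow> P q \<Longrightarrow> P (p + q)"
  shows "P p"
proof -
  have "P (\<Sum>i\<in>A. Polynomial.monom (Polynomial.coeff p i) i)" if "finite A" for A
    using that assms(1)[of 0 0] by induction (auto intro: assms)
  then show ?thesis
    using poly_as_sum_of_monoms[of p] by (metis finite_atMost)
qed

lemma (in group) eval_at_mult:
  assumes x: "x \<in> carrier G"
  shows "eval_at G x (f * g) = eval_at G x f \<otimes>\<^bsub>group_ring G\<^esub> eval_at G x g"
proof (induction f rule: poly_monom_induct)
  case (monom a i)
  show ?case
  proof (induction g rule: poly_monom_induct)
    case (monom b j)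
    show ?case using x
      by (simp add: mult_monom eval_at_monom group_ring_mult_cmul group_ring_mult_frag_of nat_pow_mult mult.commute)
  qed (simp add: distrib_left eval_at_add group_ring_mult_add)
qed (simp add: distrib_right eval_at_add group_ring_mult_add)

lemma cong_monom_minus_1:
  fixes p :: "int poly"
  assumes "m > 0"
  shows "\<exists>r. (\<forall>i\<ge>m. Polynomial.coeff r i = 0) \<and> (Polynomial.monom 1 m - 1) dvd p - r"
proof (induction p rule: poly_monom_induct)
  case (monom a i)
  have "Polynomial.monom a i - Polynomial.monom a (i mod m) =
      Polynomial.monom a (i mod m) * (Polynomial.monom 1 m ^ (i div m) - 1)"
    by (simp add: algebra_simps Polynomial.monom_power mult_monom)
  moreover have "(Polynomial.monom 1 m - 1) dvd (Polynomial.monom (1::int) m ^ (i div m) - 1)"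
    by (metis dvd_triv_left power_diff_1_eq)
  ultimately have "(Polynomial.monom 1 m - 1) dvd Polynomial.monom a i - Polynomial.monom a (i mod m)"
    by simp
  moreover have "Polynomial.coeff (Polynomial.monom a (i mod m)) j = 0" if "j \<ge> m" for j
    using that mod_less_divisor[OF assms, of i] by simp
  ultimately show ?case by blast
next
  case (add p q)
  from add.IH(1) obtain r where r: "\<forall>i\<ge>m. Polynomial.coeff r i = 0"
    "(Polynomial.monom 1 m - 1) dvd p - r" by (elim exE conjE)
  from add.IH(2) obtain s where s: "\<forall>i\<ge>m. Polynomial.coeff s i = 0"
    "(Polynomial.monom 1 m - 1) dvd q - s" by (elim exE conjE)
  have "(Polynomial.monom 1 m - 1) dvd p + q - (r + s)"
    using dvd_add[OF r(2) s(2)] by (simp only: add_diff_add)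
  with r(1) s(1) show ?case by (intro exI[of _ "r + s"]) simp
qed

lemma (in group) eval_at_eq_0_iff:
  assumes x: "x \<in> carrier G" and m: "ord x = m" "m > 0"
  shows "eval_at G x p = 0 \<longleftrightarrow> (Polynomial.monom 1 m - 1) dvd p"
proof
  have 0: "eval_at G x (Polynomial.monom 1 m - 1) = 0"
    using x m by (simp add: eval_at_diff eval_at_monom flip: m(1))
  then show "eval_at G x p = 0" if "(Polynomial.monom 1 m - 1) dvd p"
    using that x by (auto elim!: dvdE simp: eval_at_mult group_ring_mult_0)
  assume p: "eval_at G x p = 0"
  obtain r where r: "\<forall>i\<ge>m. Polynomial.coeff r i = 0" "(Polynomial.monom 1 m - 1) dvd p - r"
    using cong_monom_minus_1[OF m(2)] by blast
  have "eval_at G x r = 0"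
    using p eval_at_diff[of G x p r]
    by (metis (no_types) "0" diff_zero dvdE eval_at_mult group_ring_mult_0(1) r(2) right_minus_eq x)
  moreover have "degree r \<le> m - 1"
    using r(1) m(2) by (intro degree_le) auto
  ultimately have s: "(\<Sum>i\<le>m-1. frag_cmul (Polynomial.coeff r i) (frag_of (x [^] i))) = 0"
    by (simp add: eval_at_upper)
  have inj: "x [^] i = x [^] j \<longleftrightarrow> i = j" if "i \<le> m - 1" "j \<le> m - 1" for i j
    using ord_inj[OF x] that m by (auto simp: inj_on_def)
  have "Polynomial.coeff r j = 0" if "j \<le> m - 1" for j
  proof -
    have "0 = Poly_Mapping.lookup (\<Sum>i\<le>m-1. frag_cmul (Polynomial.coeff r i) (frag_of (x [^] i))) (x [^] j)"
      by (simp only: s lookup_zero)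
    also have "\<dots> = (\<Sum>i\<le>m-1. if i = j then Polynomial.coeff r i else 0)"
      unfolding lookup_sum using inj that by (intro sum.cong) auto
    also have "\<dots> = Polynomial.coeff r j" using that by simp
    finally show ?thesis by simp
  qed
  then have "r = 0" using r(1) m(2) by (intro poly_eqI) (metis Suc_pred' coeff_0 not_less_eq_eq)
  then show "(Polynomial.monom 1 m - 1) dvd p" using r(2) by simp
qed

text \<open>An inverse of \<open>f(x)\<close> can be restricted to the subgroup generated by \<open>x\<close>.\<close>

lemma (in group) eval_at_unit_iff:
  assumes x: "x \<in> carrier G" and m: "ord x = m" "m > 0"
  shows "eval_at G x f \<in> Units (group_ring G) \<longleftrightarrow> (\<exists>g. (Polynomial.monom 1 m - 1) dvd f * g - 1)"
proof
  assume "\<exists>g. (Polynomial.monom 1 m - 1) dvd f * g - 1"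
  then obtain g where "eval_at G x (f * g - 1) = 0"
    using eval_at_eq_0_iff[OF x m] by blast
  then have "eval_at G x (f * g) = \<one>\<^bsub>group_ring G\<^esub>"
    by (simp add: eval_at_diff one_group_ring)
  then show "eval_at G x f \<in> Units (group_ring G)"
    using eval_at_mult[OF x, of f g] eval_at_mult[OF x, of g f] eval_at_closed[OF x]
    unfolding Units_def by (auto simp: mult.commute[of f g])
next
  assume "eval_at G x f \<in> Units (group_ring G)"
  then obtain v where v: "v \<in> carrier (group_ring G)"
    "eval_at G x f \<otimes>\<^bsub>group_ring G\<^esub> v = frag_of \<one>"
    by (auto simp: Units_def one_group_ring)
  define H where "H = range (\<lambda>i::nat. x [^] i)"
  define R where "R = frag_extend (\<lambda>y. if y \<in> H then frag_of y else 0)"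
  have R_diff: "R (a - b) = R a - R b" and R_add: "R (a + b) = R a + R b"
    and R_cmul: "R (frag_cmul k a) = frag_cmul k (R a)" and R_0: "R 0 = 0" for a b k
    by (simp_all add: R_def frag_extend_diff frag_extend_add frag_extend_cmul)
  have H_mult: "x [^] i \<otimes> y \<in> H \<longleftrightarrow> y \<in> H" if y: "y \<in> carrier G" for i :: nat and y
  proof
    assume "y \<in> H"
    then show "x [^] i \<otimes> y \<in> H" using x by (auto simp: H_def nat_pow_mult)
  next
    assume "x [^] i \<otimes> y \<in> H"
    then obtain j where j: "x [^] i \<otimes> y = x [^] (j::nat)" by (auto simp: H_def)
    have "x [^] (m * i) = \<one>" using x m pow_eq_id by simp
    then have "y = x [^] (m * i - i + i) \<otimes> y" using y m(2) by simp
    also have "\<dots> = x [^] (m * i - i) \<otimes> (x [^] i \<otimes> y)"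
      using x y by (simp add: nat_pow_mult flip: m_assoc)
    finally show "y \<in> H" using x unfolding j H_def by (simp add: nat_pow_mult)
  qed
  have "R (eval_at G x f \<otimes>\<^bsub>group_ring G\<^esub> v) = eval_at G x f \<otimes>\<^bsub>group_ring G\<^esub> R v"
  proof (induction f rule: poly_monom_induct)
    case (monom a i)
    show ?case using v(1)
    proof (induction v rule: group_ring_induct)
      case (one g)
      then show ?case
        by (simp add: eval_at_monom group_ring_mult_cmul group_ring_mult_frag_of R_cmul)
           (simp add: R_def H_mult group_ring_mult_frag_of group_ring_mult_0)
    qed (auto simp: R_diff R_0 group_ring_mult_diff group_ring_mult_0)
  qed (simp add: eval_at_add group_ring_mult_add R_add)
  moreover have "\<one> \<in> H" unfolding H_def by (rule range_eqI[of _ _ 0]) simp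
  ultimately have 1: "eval_at G x f \<otimes>\<^bsub>group_ring G\<^esub> R v = frag_of \<one>"
    by (simp add: v(2) R_def)
  have "\<exists>g. R v = eval_at G x g" using v(1)
  proof (induction v rule: group_ring_induct)
    case zero
    show ?case by (rule exI[of _ 0]) (simp add: R_0)
  next
    case (one y)
    show ?case
    proof (cases "y \<in> H")
      case True
      then obtain i :: nat where "y = x [^] i" by (auto simp: H_def)
      with True show ?thesis
        by (intro exI[of _ "Polynomial.monom 1 i"]) (simp add: R_def eval_at_monom)
    next
      case False
      then show ?thesis by (intro exI[of _ 0]) (simp add: R_def)
    qed
  next
    case (diff a b)
    then show ?case by (metis R_diff eval_at_diff)
  qed
  then obtain g where "R v = eval_at G x g" ..
  with 1 have "eval_at G x (f * g - 1) = 0"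
    using x by (simp add: eval_at_diff eval_at_mult)
  then show "\<exists>g. (Polynomial.monom 1 m - 1) dvd f * g - 1"
    using eval_at_eq_0_iff[OF x m] by blast
qed

lemma ord_integer_mod_group:
  assumes "m > 0"
  shows "1 mod int m \<in> carrier (integer_mod_group m)"
    and "group.ord (integer_mod_group m) (1 mod int m) = m"
proof -
  show c: "1 mod int m \<in> carrier (integer_mod_group m)"
    using assms by (simp add: carrier_integer_mod_group)
  have "(int n * (1 mod int m)) mod int m = 0 \<longleftrightarrow> m dvd n" for n
    by (simp add: mod_mult_right_eq flip: dvd_eq_mod_eq_0)
  then show "group.ord (integer_mod_group m) (1 mod int m) = m"
    using c by (subst group.ord_unique) (auto simp: pow_integer_mod_group)
qed

lemma defines_unit_on_order_iff_quotient:
  assumes "m > 0"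
  shows "defines_unit_on_order f m \<longleftrightarrow> (\<exists>g. (Polynomial.monom 1 m - 1) dvd f * g - 1)"
  unfolding defines_unit_on_order_def
  by (rule group.eval_at_unit_iff[OF group_integer_mod_group]) (use assms ord_integer_mod_group in simp_all)

lemma defines_unit_on_order_iff:
  assumes "group G" "x \<in> carrier G" "group.ord G x = m" "m > 0"
  shows "defines_unit_on_order f m \<longleftrightarrow> eval_at G x f \<in> Units (group_ring G)"
  unfolding defines_unit_on_order_iff_quotient[OF assms(4)] by (rule group.eval_at_unit_iff[OF assms, symmetric])

end

theory Submission
  imports Defs "Jordan_Normal_Form.Determinant" "HOL-Number_Theory.Residues"
    "HOL-Computational_Algebra.Squarefree"
    "HOL-Computational_Algebra.Fundamental_Theorem_Algebra"
begin

text \<open>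
  Let \<open>\<alpha> i\<close>, \<open>i < N = n - d\<close>, be the nonzero complex roots of \<open>f\<close>. Up to sign, \<open>f\<close> defines a unit
  on order \<open>m\<close> iff the resultant \<open>v m = c_n^m \<Prod>i. (\<alpha> i^m - 1)\<close> is \<open>1\<close> or \<open>-1\<close>. Choose a small odd
  prime \<open>p\<close> not dividing \<open>c_d c_n\<close> and a valuation ring \<open>V\<close> of the complex numbers in which \<open>p\<close> is not
  invertible. By the pigeonhole principle there is \<open>e \<le> p^N\<close> such that all \<open>\<alpha> i^e\<close> are \<open>1\<close> modulo
  \<open>p\<close>; put \<open>E = e (p - 1)\<close>. On a residue class modulo \<open>E\<close> the sign of \<open>v m\<close> is determined modulo
  \<open>p\<close>, and \<open>v (r + E x) - \<sigma>\<close> is an exponential sum in \<open>x\<close> with \<open>2^N + 1\<close> terms and bases \<open>1\<close>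
  modulo \<open>p\<close>. If it vanishes identically, then \<open>f\<close> defines a unit on every order in the class, hence
  on all their divisors, hence on every order coprime to \<open>E\<close>, so it defines generic units. Otherwise
  the method of Skolem and Strassmann shows that it has fewer than \<open>2^(N + 1)\<close> zeros. No form of the
  S-unit theorem is needed.
\<close>

section \<open>Valuation rings of a field\<close>

text \<open>Subrings are plain sets in a field type, so that quotients are formed in the field and
  membership in \<open>V\<close> expresses integrality.\<close>

locale subring_of_field =
  fixes V :: "'a :: field set"
  assumes one_mem: "1 \<in> V"
    and diff_mem: "x \<in> V \<Longrightarrow> y \<in> V \<Longrightarrow> x - y \<in> V"
    and mult_mem: "x \<in> V \<Longrightarrow> y \<in> V \<Longrightarrow> x * y \<in> V"
begin

lemma zero_mem: "0 \<in> V"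
  using diff_mem[OF one_mem one_mem] by simp

lemma minus_mem: "x \<in> V \<Longrightarrow> - x \<in> V"
  using diff_mem[OF zero_mem] by simp

lemma add_mem: "x \<in> V \<Longrightarrow> y \<in> V \<Longrightarrow> x + y \<in> V"
  using diff_mem[OF _ minus_mem] by (metis diff_minus_eq_add)

lemma sum_mem: "(\<And>i. i \<in> A \<Longrightarrow> f i \<in> V) \<Longrightarrow> sum f A \<in> V"
  by (induction A rule: infinite_finite_induct) (auto intro: zero_mem add_mem)

lemma prod_mem: "(\<And>i. i \<in> A \<Longrightarrow> f i \<in> V) \<Longrightarrow> prod f A \<in> V"
  by (induction A rule: infinite_finite_induct) (auto intro: one_mem mult_mem)

lemma power_mem: "x \<in> V \<Longrightarrow> x ^ n \<in> V"
  by (induction n) (auto intro: one_mem mult_mem)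

lemma of_nat_mem: "of_nat n \<in> V"
  by (induction n) (auto intro: zero_mem one_mem add_mem)

lemma of_int_mem: "of_int z \<in> V"
  by (cases z rule: int_cases2) (auto intro: of_nat_mem minus_mem)

lemma coeff_mult_mem:
  "(\<And>i. poly.coeff q i \<in> V) \<Longrightarrow> (\<And>i. poly.coeff r i \<in> V) \<Longrightarrow> poly.coeff (q * r) i \<in> V"
  unfolding coeff_mult by (intro sum_mem mult_mem) auto

lemma coeff_prod_mem:
  "(\<And>x i. x \<in> A \<Longrightarrow> poly.coeff (q x) i \<in> V) \<Longrightarrow> poly.coeff (prod q A) i \<in> V"
proof (induction A arbitrary: i rule: infinite_finite_induct)
  case (insert x A)
  then show ?case by (auto intro!: coeff_mult_mem)
qed (auto intro: zero_mem one_mem)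

definition adjoin :: "'a \<Rightarrow> 'a set" where
  "adjoin z = {poly q z | q. \<forall>i. poly.coeff q i \<in> V}"

lemma adjoin_subring: "subring_of_field (adjoin z)"
proof
  show "1 \<in> adjoin z"
    unfolding adjoin_def by (intro CollectI exI[of _ 1]) (auto intro: one_mem zero_mem)
  fix x y assume "x \<in> adjoin z" "y \<in> adjoin z"
  then obtain q r where "x = poly q z" "y = poly r z"
    "\<forall>i. poly.coeff q i \<in> V" "\<forall>i. poly.coeff r i \<in> V"
    unfolding adjoin_def by blast
  then show "x - y \<in> adjoin z" "x * y \<in> adjoin z"
    unfolding adjoin_def
    by (intro CollectI exI[of _ "q - r"] exI[of _ "q * r"]; simp add: diff_mem coeff_mult_mem)+
qed

lemma subset_adjoin: "V \<subseteq> adjoin z"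
proof
  fix x assume "x \<in> V"
  then show "x \<in> adjoin z"
    unfolding adjoin_def
    by (intro CollectI exI[of _ "[:x:]"]) (auto simp: coeff_pCons zero_mem split: nat.splits)
qed

lemma mem_adjoin: "z \<in> adjoin z"
  unfolding adjoin_def
  by (intro CollectI exI[of _ "[:0, 1:]"]) (auto simp: coeff_pCons zero_mem one_mem split: nat.splits)

end

locale valuation_ring = subring_of_field +
  assumes total: "x \<in> V \<or> inverse x \<in> V"

text \<open>Chevalley's extension theorem. Zorn's lemma gives a subring that is maximal among those
  containing \<open>V\<close> but not 1/a; maximality forces it to contain \<open>z\<close> or 1/z
  for every \<open>z\<close>.\<close>

lemma valuation_ring_exists:
  fixes V :: "'a :: field set" and a :: 'a
  assumes "subring_of_field V" "a \<in> V" "inverse a \<notin> V"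
  shows "\<exists>W. valuation_ring W \<and> V \<subseteq> W \<and> inverse a \<notin> W"
proof -
  define R where "R = {W. subring_of_field W \<and> V \<subseteq> W \<and> inverse a \<notin> W}"
  have "\<exists>W\<in>R. \<forall>X\<in>R. W \<subseteq> X \<longrightarrow> X = W"
  proof (rule subset_Zorn_nonempty)
    show "R \<noteq> {}" using assms by (auto simp: R_def)
    fix C assume C: "C \<noteq> {}" "subset.chain R C"
    then have CR: "W \<in> C \<Longrightarrow> W \<in> R" for W by (auto simp: subset.chain_def)
    have common: "\<exists>W\<in>C. x \<in> W \<and> y \<in> W" if xy: "x \<in> \<Union>C" "y \<in> \<Union>C" for x y
    proof -
      obtain X Y where "X \<in> C" "Y \<in> C" "x \<in> X" "y \<in> Y" using xy by blast
      moreover from this have "X \<subseteq> Y \<or> Y \<subseteq> X" using C(2) unfolding subset.chain_def by blast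
      ultimately show ?thesis by blast
    qed
    show "\<Union>C \<in> R" unfolding R_def
    proof (intro CollectI conjI)
      show "subring_of_field (\<Union>C)"
      proof
        show "1 \<in> \<Union>C" using C(1) CR by (auto simp: R_def intro: subring_of_field.one_mem)
        fix x y assume "x \<in> \<Union>C" "y \<in> \<Union>C"
        then obtain W where W: "W \<in> C" "x \<in> W" "y \<in> W" using common by blast
        then have "subring_of_field W" using CR by (auto simp: R_def)
        with W show "x - y \<in> \<Union>C" "x * y \<in> \<Union>C"
          by (auto intro: subring_of_field.diff_mem subring_of_field.mult_mem)
      qed
      show "V \<subseteq> \<Union>C" "inverse a \<notin> \<Union>C" using C(1) CR by (auto simp: R_def)
    qed
  qed
  then obtain W where WR: "W \<in> R" and max: "\<And>X. X \<in> R \<Longrightarrow> W \<subseteq> X \<Longrightarrow> X = W" by blast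
  interpret W: subring_of_field W using WR by (simp add: R_def)
  have VW: "V \<subseteq> W" and aW: "inverse a \<notin> W" using WR by (auto simp: R_def)
  have "a \<in> W" using assms(2) VW by blast
  have a0: "a \<noteq> 0" using aW W.zero_mem by auto
  \<comment> \<open>By maximality W[z] contains 1/a, which amounts to a polynomial relation for
    \<open>z\<close> over \<open>W\<close>.\<close>
  have adj: "\<exists>q. (\<forall>i. poly.coeff q i \<in> W) \<and> a * poly q z = 1" if "z \<notin> W" for z
  proof -
    have "W.adjoin z \<notin> R" using max[of "W.adjoin z"] W.subset_adjoin W.mem_adjoin that by auto
    then have "inverse a \<in> W.adjoin z"
      using VW W.subset_adjoin[of z] W.adjoin_subring unfolding R_def by blast
    then show ?thesis using a0 by (auto simp: W.adjoin_def field_simps)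
  qed
  \<comment> \<open>Otherwise the relation for 1/u, multiplied by u^(deg q), which is 1 modulo
    \<open>a\<close>, would make \<open>a\<close> invertible in \<open>W\<close>.\<close>
  have unit: "inverse (1 - a * b) \<in> W" if b: "b \<in> W" for b
  proof (rule ccontr)
    define u where "u = 1 - a * b"
    assume nu: "inverse (1 - a * b) \<notin> W"
    then obtain q where q: "\<And>i. poly.coeff q i \<in> W" "a * poly q (inverse u) = 1"
      using adj unfolding u_def by metis
    have u0: "u \<noteq> 0" using nu W.zero_mem unfolding u_def by auto
    have uW: "u \<in> W" unfolding u_def using b \<open>a \<in> W\<close> by (intro W.diff_mem W.one_mem W.mult_mem)
    have "\<exists>b'\<in>W. u ^ n = 1 - a * b'" for n
    proof (induction n)
      case 0
      then show ?case by (intro bexI[of _ 0]) (auto intro: W.zero_mem)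
    next
      case (Suc n)
      then obtain b' where "b' \<in> W" "u ^ n = 1 - a * b'" by blast
      then show ?case using b \<open>a \<in> W\<close>
        by (intro bexI[of _ "b' + b * u ^ n"])
           (auto simp: u_def algebra_simps intro!: W.add_mem W.mult_mem W.power_mem W.diff_mem W.one_mem)
    qed
    then obtain b' where b': "b' \<in> W" "u ^ degree q = 1 - a * b'" by blast
    define s where "s = (\<Sum>i\<le>degree q. poly.coeff q i * u ^ (degree q - i))"
    have sW: "s \<in> W" unfolding s_def by (intro W.sum_mem W.mult_mem W.power_mem q uW)
    have "u ^ degree q * poly q (inverse u) = s"
      unfolding poly_altdef s_def sum_distrib_left
      by (rule sum.cong) (auto simp: u0 power_diff power_inverse field_simps)
    then have "u ^ degree q = a * s" using q(2) by (metis mult.left_commute mult.right_neutral)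
    then have "1 = a * (b' + s)" using b' by (simp add: algebra_simps)
    then have "inverse a = b' + s" using a0 by (simp add: field_simps)
    then show False using aW W.add_mem b' sW by metis
  qed
  have "z \<in> W \<or> inverse z \<in> W" for z
  proof (rule ccontr)
    assume "\<not> (z \<in> W \<or> inverse z \<in> W)"
    then have z: "z \<notin> W" "inverse z \<notin> W" by auto
    \<comment> \<open>\<open>P z n\<close> records a relation of degree \<open>n\<close> for
      \<open>z\<close>. The minimal degrees for \<open>z\<close> and 1/z are compared; by symmetry
      the one for 1/z may be taken not to be the larger, and its relation then shortens the one for
      \<open>z\<close>.\<close>
    define P where "P = (\<lambda>z n. \<exists>q. (\<forall>i. poly.coeff q i \<in> W) \<and> a * poly q z = 1 \<and> degree q = n)"
    have P: "Ex (P z)" if "z \<notin> W" for z using adj[OF that] unfolding P_def by metis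
    have main: False
      if z: "z \<notin> W" "inverse z \<notin> W" and le: "Least (P (inverse z)) \<le> Least (P z)" for z
    proof -
      define n where "n = Least (P z)"
      define l where "l = Least (P (inverse z))"
      have "P z n" unfolding n_def using P[OF z(1)] by (rule LeastI_ex)
      then obtain q where q: "\<And>i. poly.coeff q i \<in> W" "a * poly q z = 1" "degree q = n"
        unfolding P_def by blast
      have "P (inverse z) l" unfolding l_def using P[OF z(2)] by (rule LeastI_ex)
      then obtain r where r: "\<And>i. poly.coeff r i \<in> W" "a * poly r (inverse z) = 1" "degree r = l"
        unfolding P_def by blast
      have z0: "z \<noteq> 0" using z W.zero_mem by auto
      define u where "u = 1 - a * poly.coeff r 0"
      have uW: "inverse u \<in> W" unfolding u_def using r(1) by (rule unit)
      have u0: "u \<noteq> 0"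
      proof
        assume "u = 0"
        then have "inverse a = poly.coeff r 0" using a0 unfolding u_def by (simp add: field_simps)
        then show False using aW r(1) by metis
      qed
      \<comment> \<open>Multiplying the relation for 1/z by z^l and dividing by the unit
        \<open>u\<close> expresses z^l through lower powers of \<open>z\<close>.\<close>
      define s where "s = (\<Sum>i=1..l. Polynomial.monom (a * inverse u * poly.coeff r i) (l - i))"
      have zl: "z ^ l = poly s z"
      proof -
        have "1 = a * (\<Sum>i=0..l. poly.coeff r i * inverse z ^ i)"
          using r(2,3) by (simp add: poly_altdef atLeast0AtMost)
        also have "\<dots> = a * poly.coeff r 0 + (\<Sum>i=1..l. a * poly.coeff r i * inverse z ^ i)"
          by (simp add: sum.atLeast_Suc_atMost algebra_simps sum_distrib_left)
        finally have "u = (\<Sum>i=1..l. a * poly.coeff r i * inverse z ^ i)"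
          unfolding u_def by (simp add: algebra_simps)
        then have "z ^ l * u = z ^ l * (\<Sum>i=1..l. a * poly.coeff r i * inverse z ^ i)"
          by simp
        also have "\<dots> = (\<Sum>i=1..l. a * poly.coeff r i * z ^ (l - i))"
          using z0 unfolding sum_distrib_left
          by (intro sum.cong) (auto simp: power_diff field_simps)
        finally have "z ^ l = inverse u * (\<Sum>i=1..l. a * poly.coeff r i * z ^ (l - i))"
          using u0 by (simp add: field_simps)
        then show ?thesis
          by (simp add: s_def poly_sum poly_monom sum_distrib_left algebra_simps)
      qed
      have "n > 0"
      proof (rule ccontr)
        assume "\<not> n > 0"
        then have "a * poly.coeff q 0 = 1" using q(2,3) by (simp add: poly_altdef)
        then have "inverse a = poly.coeff q 0" using a0 by (simp add: field_simps)
        then show False using aW q(1) by metis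
      qed
      have "l > 0"
      proof (rule ccontr)
        assume "\<not> l > 0"
        then have "a * poly.coeff r 0 = 1" using r(2,3) by (simp add: poly_altdef)
        then show False using u0 u_def by simp
      qed
      have ln: "l \<le> n" using le unfolding l_def n_def .
      have s_coeff: "poly.coeff s i \<in> W" for i
        unfolding s_def coeff_sum using r(1) uW \<open>a \<in> W\<close>
        by (intro W.sum_mem) (auto intro!: W.mult_mem W.zero_mem)
      have s_high: "poly.coeff s i = 0" if "i \<ge> l" for i
        unfolding s_def coeff_sum using that by (intro sum.neutral) auto
      \<comment> \<open>The leading term of \<open>q\<close> is rewritten by z^l = s(z), which
        lowers the degree without changing the value at \<open>z\<close>.\<close>
      define t where
        "t = q - Polynomial.monom (poly.coeff q n) n + Polynomial.monom (poly.coeff q n) (n - l) * s"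
      have "poly t z = poly q z"
        using ln by (simp add: t_def poly_monom flip: zl) (simp flip: power_add)
      moreover have tW: "poly.coeff t i \<in> W" for i
        unfolding t_def coeff_add coeff_diff using q(1) s_coeff
        by (intro W.diff_mem W.add_mem W.coeff_mult_mem) (auto intro: W.zero_mem)
      moreover have "poly.coeff t i = 0" if "i > n - 1" for i
      proof -
        have "i \<ge> n" using that by simp
        moreover have "poly.coeff (Polynomial.monom (poly.coeff q n) (n - l) * s) i = 0"
          using calculation ln s_high[of "i - (n - l)"] by (auto simp: coeff_monom_mult)
        ultimately show ?thesis using q(3) by (auto simp: t_def coeff_eq_0)
      qed
      then have "degree t \<le> n - 1" by (intro degree_le) auto
      ultimately have "P z (degree t)" unfolding P_def using q(2) by metis
      then have "n \<le> degree t" unfolding n_def by (rule Least_le)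
      with \<open>degree t \<le> n - 1\<close> \<open>n > 0\<close> show False by simp
    qed
    show False
      using main[OF z] main[of "inverse z"] z by (cases "Least (P (inverse z)) \<le> Least (P z)") auto
  qed
  then have "valuation_ring W" by unfold_locales auto
  then show ?thesis using VW aW by blast
qed

section \<open>The maximal ideal and divisibility in a valuation ring\<close>

context valuation_ring
begin

text \<open>The maximal ideal. Zero has its own disjunct because \<open>inverse 0 = 0\<close> lies
  in \<open>V\<close>.\<close>

definition nonunits :: "'a set" where
  "nonunits = {x \<in> V. x = 0 \<or> inverse x \<notin> V}"

lemma nonunits_mem: "x \<in> nonunits \<Longrightarrow> x \<in> V"
  by (simp add: nonunits_def)

lemma one_notin_nonunits: "1 \<notin> nonunits"
  by (simp add: nonunits_def one_mem)

lemma zero_nonunit: "0 \<in> nonunits"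
  by (simp add: nonunits_def zero_mem)

lemma nonunits_mult: "x \<in> nonunits \<Longrightarrow> y \<in> V \<Longrightarrow> x * y \<in> nonunits"
  unfolding nonunits_def using mult_mem[of "inverse (x * y)" y]
  by (auto simp: mult_mem field_simps)

text \<open>One of x/y and y/x lies in \<open>V\<close>, so the sum is a multiple in
  \<open>V\<close> of one of the summands.\<close>

lemma nonunits_add: "x \<in> nonunits \<Longrightarrow> y \<in> nonunits \<Longrightarrow> x + y \<in> nonunits"
proof -
  have *: "x + y \<in> nonunits" if "x \<in> nonunits" "y \<in> nonunits" "x / y \<in> V" "y \<noteq> 0" for x y
  proof -
    have "y * (1 + x / y) \<in> nonunits"
      using that by (intro nonunits_mult add_mem one_mem) auto
    moreover have "y * (1 + x / y) = x + y" using that(4) by (simp add: distrib_left)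
    ultimately show ?thesis by simp
  qed
  assume xy: "x \<in> nonunits" "y \<in> nonunits"
  show ?thesis
  proof (cases "x = 0 \<or> y = 0")
    case True
    then show ?thesis using xy by auto
  next
    case False
    have "x / y \<in> V \<or> y / x \<in> V" using total[of "x / y"] by (simp add: field_simps)
    then show ?thesis using *[of x y] *[of y x] xy False by (auto simp: add.commute)
  qed
qed

lemma nonunits_sum: "(\<And>i. i \<in> A \<Longrightarrow> f i \<in> nonunits) \<Longrightarrow> sum f A \<in> nonunits"
  by (induction A rule: infinite_finite_induct) (auto intro: nonunits_add zero_nonunit)

lemma nonunits_minus: "x \<in> nonunits \<Longrightarrow> - x \<in> nonunits"
  using nonunits_mult[OF _ minus_mem[OF one_mem]] by simp

lemma notin_nonunits_iff: "x \<in> V \<Longrightarrow> x \<notin> nonunits \<longleftrightarrow> x \<noteq> 0 \<and> inverse x \<in> V"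
  by (auto simp: nonunits_def)

text \<open>If \<open>x\<close> is not in \<open>V\<close>, then 1/x is, and dividing the monic
  equation by x^(n-1) writes \<open>x\<close> as a polynomial in 1/x over \<open>V\<close>.\<close>

lemma integrally_closed:
  assumes "poly q x = 0" "lead_coeff q = 1" "\<And>i. poly.coeff q i \<in> V"
  shows "x \<in> V"
proof (rule ccontr)
  assume x: "x \<notin> V"
  then have inv: "inverse x \<in> V" and x0: "x \<noteq> 0" using total[of x] zero_mem by auto
  define n where "n = degree q"
  have "n > 0"
  proof (rule ccontr)
    assume "\<not> n > 0"
    then have "poly q x = 1" using assms(2) by (simp add: poly_altdef n_def)
    then show False using assms(1) by simp
  qed
  then obtain k where k: "n = Suc k" by (metis gr0_implies_Suc)
  have "0 = (\<Sum>i\<le>k. poly.coeff q i * x ^ i) + x ^ Suc k"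
    using assms(1,2) k by (simp add: poly_altdef n_def)
  then have "x * x ^ k = - (\<Sum>i\<le>k. poly.coeff q i * x ^ i)"
    by (simp add: add_eq_0_iff)
  then have "x = - (\<Sum>i\<le>k. poly.coeff q i * x ^ i) / x ^ k"
    using x0 by (simp add: field_simps)
  also have "\<dots> = - (\<Sum>i\<le>k. poly.coeff q i * inverse x ^ (k - i))"
    unfolding minus_divide_left[symmetric] sum_divide_distrib
    by (intro arg_cong[where f = uminus] sum.cong) (auto simp: power_diff x0 field_simps)
  also have "\<dots> \<in> V" using assms(3) inv by (intro minus_mem sum_mem mult_mem power_mem)
  finally show False using x by simp
qed

text \<open>The index found is the last one at which the valuation is minimal, as in Strassmann's
  theorem. The induction adds the largest index: it takes over unless its quotient by the current
  choice is a nonunit.\<close>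

lemma exists_dividing_all:
  fixes f :: "nat \<Rightarrow> 'a"
  assumes "finite A" "j \<in> A" "f j \<noteq> 0"
  shows "\<exists>i\<in>A. f i \<noteq> 0 \<and> (\<forall>l\<in>A. f l / f i \<in> V \<and> (i < l \<longrightarrow> f l / f i \<in> nonunits))"
  using assms
proof (induction A arbitrary: j rule: finite_linorder_max_induct)
  case (insert b A)
  show ?case
  proof (cases "\<forall>l\<in>A. f l = 0")
    case True
    then have "f b \<noteq> 0" using insert by auto
    then show ?thesis using True insert.hyps one_mem zero_mem by (intro bexI[of _ b]) auto
  next
    case False
    then obtain i where i: "i \<in> A" "f i \<noteq> 0"
      "\<And>l. l \<in> A \<Longrightarrow> f l / f i \<in> V" "\<And>l. l \<in> A \<Longrightarrow> i < l \<Longrightarrow> f l / f i \<in> nonunits"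
      using insert.IH by blast
    show ?thesis
    proof (cases "f b / f i \<in> nonunits")
      case True
      then show ?thesis using i by (intro bexI[of _ i]) (auto intro: nonunits_mem)
    next
      case F: False
      have b0: "f b \<noteq> 0" and ib: "f i / f b \<in> V"
        using F total[of "f b / f i"] zero_mem by (auto simp: nonunits_def)
      have "f l / f b \<in> V" if "l \<in> A" for l
        using mult_mem[OF i(3)[OF that] ib] i(2) by simp
      then show ?thesis using b0 insert.hyps(2) one_mem
        by (intro bexI[of _ b]) fastforce+
    qed
  qed
qed auto

end

section \<open>Zeros of p-adic exponential sums\<close>

lemma poly_map_poly_of_int:
  "poly (map_poly of_int q) (of_int x :: 'a :: comm_ring_1) = of_int (poly q x)"
  by (induction q) (auto simp: map_poly_pCons)

text \<open>Pseudo-division by a monic polynomial is genuine division. Bounding the remainder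
  through its coefficients also covers a zero remainder and a constant divisor.\<close>

lemma monic_remainder:
  fixes g :: "'a :: {comm_ring_1, semiring_1_no_zero_divisors} poly"
  assumes "lead_coeff g = 1"
  shows "\<exists>q r. f = g * q + r \<and> (\<forall>i\<ge>degree g. poly.coeff r i = 0)"
proof -
  obtain q r where qr: "pseudo_divmod f g = (q, r)" by force
  have "g \<noteq> 0" using assms by auto
  from pseudo_divmod[OF this qr] assms have "f = g * q + r" "r = 0 \<or> degree r < degree g" by auto
  then show ?thesis by (metis coeff_0 coeff_eq_0 order_less_le_trans)
qed

text \<open>Kept over the integers so that remainders modulo a monic integer polynomial have integer
  coefficients, which lie in every \<open>V\<close>.\<close>

definition falling_poly :: "nat \<Rightarrow> int poly" where
  "falling_poly j = (\<Prod>i<j. [:- int i, 1:])"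

lemma degree_falling_poly: "degree (falling_poly j) = j"
  unfolding falling_poly_def by (subst degree_prod_eq_sum_degree) auto

lemma lead_coeff_falling_poly: "lead_coeff (falling_poly j) = 1"
  unfolding falling_poly_def by (simp add: lead_coeff_prod)

lemma poly_falling_poly: "poly (falling_poly j) (int x) = fact j * int (x choose j)"
proof -
  have "of_int (poly (falling_poly j) (int x)) = (\<Prod>i<j. (of_nat x - of_nat i :: rat))"
    by (simp add: falling_poly_def poly_prod)
  also have "\<dots> = fact j * of_nat (x choose j)"
    by (simp add: binomial_gbinomial gbinomial_mult_fact atLeast0LessThan)
  finally have "(of_int (poly (falling_poly j) (int x)) :: rat) = of_int (fact j * int (x choose j))"
    by simp
  then show ?thesis by (simp only: of_int_eq_iff)
qed

text \<open>Legendre's recursion v(n!) = q + v(q!) with q = n div p, together with 3q \<le> n for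
  odd \<open>p\<close>. For p = 2 the bound fails, which is why an odd prime is chosen.\<close>

lemma multiplicity_fact_less:
  fixes p :: nat
  assumes p: "prime p" "p > 2" and "n > 0"
  shows "2 * multiplicity p (fact n :: nat) < n"
  using \<open>n > 0\<close>
proof (induction n rule: less_induct)
  case (less n)
  have p0: "p > 0" using p by simp
  \<comment> \<open>Passing from (pq)! to (p(q+1))! adds \<open>p\<close> factors, of which only the
    last is a multiple of \<open>p\<close>.\<close>
  have *: "multiplicity p (fact (p * q) :: nat) = q + multiplicity p (fact q)" for q
  proof (induction q)
    case (Suc q)
    have nd: "\<not> p dvd \<Prod>{p * q + 1..p * q + (p - 1)}"
    proof
      assume "p dvd \<Prod>{p * q + 1..p * q + (p - 1)}"
      then obtain i where i: "i \<in> {p * q + 1..p * q + (p - 1)}" "p dvd i"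
        using p(1) by (auto simp: prime_dvd_prod_iff)
      then obtain j where "i = p * j" by auto
      moreover have "p * q + 1 \<le> i" "i \<le> p * q + (p - 1)" using i by auto
      ultimately have "p * q < p * j" "p * j < p * Suc q" using p0 unfolding mult_Suc_right by linarith+
      then have "q < j" "j < Suc q" using mult_less_cancel1 by blast+
      then show False by simp
    qed
    have "fact (p * Suc q) = (\<Prod>{1..p * q + p} :: nat)"
      by (simp add: fact_prod add.commute)
    also have "{1..p * q + p} = {1..p * q} \<union> {p * q + 1..p * q + (p - 1)} \<union> {p * q + p}"
      using p0 by auto
    also have "\<Prod>\<dots> = fact (p * q) * \<Prod>{p * q + 1..p * q + (p - 1)} * (p * Suc q)"
      using p0 by (subst prod.union_disjoint, simp, simp, simp, subst prod.union_disjoint)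
        (auto simp: fact_prod algebra_simps)
    finally have "(fact (p * Suc q) :: nat) = fact (p * q) * \<Prod>{p * q + 1..p * q + (p - 1)} * (p * Suc q)" .
    moreover have "\<Prod>{p * q + 1..p * q + (p - 1)} \<noteq> 0" by (simp add: prod_zero_iff)
    ultimately have "multiplicity p (fact (p * Suc q) :: nat) =
        multiplicity p (fact (p * q) :: nat) + 0 + (1 + multiplicity p (Suc q))"
      using p nd by (simp add: prime_elem_multiplicity_mult_distrib not_dvd_imp_multiplicity_0
          del: mult_Suc_right mult_Suc fact_Suc)
    also have "\<dots> = Suc q + (multiplicity p (Suc q) + multiplicity p (fact q))"
      using Suc.IH by simp
    also have "multiplicity p (Suc q) + multiplicity p (fact q) = multiplicity p (Suc q * fact q)"
      using p by (subst prime_elem_multiplicity_mult_distrib) auto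
    finally show ?case by simp
  qed simp
  define q where "q = n div p"
  have "multiplicity p (fact (p * q + l) :: nat) = multiplicity p (fact (p * q) :: nat)" if "l < p" for l
    using that
  proof (induction l)
    case (Suc l)
    have "\<not> p dvd Suc (p * q + l)" using Suc.prems
      by (metis Suc_lessD add_Suc_right dvd_add_right_iff dvd_triv_left nat_dvd_not_less zero_less_Suc)
    then have "multiplicity p (Suc (p * q + l)) = 0" by (rule not_dvd_imp_multiplicity_0)
    then show ?case using Suc p by (simp add: prime_elem_multiplicity_mult_distrib del: mult_Suc)
  qed simp
  from this[of "n mod p"] have m: "multiplicity p (fact n :: nat) = q + multiplicity p (fact q)"
    using p0 by (simp add: q_def *)
  show ?case
  proof (cases "q = 0")
    case True
    then show ?thesis using m less.prems by simp
  next
    case False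
    have "q < n" using less.prems p by (simp add: q_def)
    then have "2 * multiplicity p (fact q :: nat) < q" using less.IH False by simp
    moreover have "3 * q \<le> n"
      using p(2) mult_le_mono2[of 3 p q] div_times_less_eq_dividend[of n p] unfolding q_def by linarith
    ultimately show ?thesis using m by simp
  qed
qed

text \<open>A valuation ring of residue characteristic \<open>p\<close>. It takes the place of the
  integers in an extension of the p-adic numbers, without completion or topology.\<close>

locale p_valuation_ring = valuation_ring V for V :: "'a :: field_char_0 set" +
  fixes p :: nat
  assumes prime_p: "prime p" and p_nonunit: "of_nat p \<in> nonunits"
begin

text \<open>A discrete version of Strassmann's theorem. The dominant coefficient is read off after
  reducing the falling factorials modulo the monic integer polynomial with the given roots.\<close>

lemma newton_series_zeros:
  fixes a :: "nat \<Rightarrow> 'a" and X :: "nat set"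
  assumes "a J \<noteq> 0" and small: "\<And>j. j > J \<Longrightarrow> a j / a J \<in> nonunits"
    and "finite X" and zeros: "\<And>x. x \<in> X \<Longrightarrow> (\<Sum>j\<le>x. a j * fact j * of_nat (x choose j)) = 0"
  shows "card X \<le> J"
proof (rule ccontr)
  assume "\<not> card X \<le> J"
  then obtain Y where Y: "Y \<subseteq> X" "card Y = Suc J"
    by (metis not_less_eq_eq obtain_subset_with_card_n)
  have finY: "finite Y" using Y by (metis card.infinite nat.distinct(1))
  define g where "g = (\<Prod>x\<in>Y. [:- int x, 1:])"
  have g: "lead_coeff g = 1" "degree g = Suc J"
    unfolding g_def using Y finY lead_coeff_prod[of "\<lambda>x. [:- int x, 1:]" Y]
    by (simp_all add: degree_prod_eq_sum_degree)
  \<comment> \<open>For \<open>j \<le> J\<close> the remainder is fixed as the falling factorial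
    itself, so its coefficient at degree \<open>J\<close> is known: 1 for \<open>j = J\<close> and 0
    below.\<close>
  have "\<exists>r. (\<exists>q. falling_poly j = g * q + r) \<and> (\<forall>i\<ge>Suc J. poly.coeff r i = 0) \<and> (j \<le> J \<longrightarrow> r = falling_poly j)"
    for j
  proof (cases "j \<le> J")
    case True
    have "\<forall>i\<ge>Suc J. poly.coeff (falling_poly j) i = 0"
      using True by (auto intro!: coeff_eq_0 simp: degree_falling_poly)
    then show ?thesis by (intro exI[of _ "falling_poly j"]) (auto intro: exI[of _ 0])
  next
    case False
    then show ?thesis using monic_remainder[OF g(1), of "falling_poly j"] g(2) by auto
  qed
  then obtain r where r: "\<And>j. \<exists>q. falling_poly j = g * q + r j"
    "\<And>j i. i \<ge> Suc J \<Longrightarrow> poly.coeff (r j) i = 0" "\<And>j. j \<le> J \<Longrightarrow> r j = falling_poly j"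
    by metis
  \<comment> \<open>Terms beyond \<open>n\<close> vanish on \<open>Y\<close>, since x choose j is 0
    for j > x. The reduced sum \<open>h\<close> has degree at most \<open>J\<close> but
    \<open>J + 1\<close> zeros, hence is zero.\<close>
  define n where "n = max J (Max Y)"
  define h where "h = (\<Sum>j\<le>n. Polynomial.smult (a j) (map_poly of_int (r j)))"
  have h_coeff: "poly.coeff h i = (\<Sum>j\<le>n. a j * of_int (poly.coeff (r j) i))" for i
    by (simp add: h_def coeff_sum coeff_map_poly)
  have root: "poly h (of_nat x) = 0" if "x \<in> Y" for x
  proof -
    have "poly g (int x) = 0" unfolding g_def poly_prod using finY that by (auto intro!: prod_zero)
    then have rx: "poly (r j) (int x) = fact j * int (x choose j)" for j
      using r(1)[of j] poly_falling_poly[of j x] by (metis add_0 mult_zero_left poly_add poly_mult)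
    have x: "x \<le> n" unfolding n_def using that finY Max_ge by (simp add: max.coboundedI2)
    have "poly h (of_nat x) = (\<Sum>j\<le>n. a j * of_int (poly (r j) (int x)))"
      using poly_map_poly_of_int[of _ "int x", where 'a = 'a] by (simp add: h_def poly_sum)
    also have "\<dots> = (\<Sum>j\<le>n. a j * fact j * of_nat (x choose j))"
      by (simp add: rx mult.assoc)
    also have "\<dots> = (\<Sum>j\<le>x. a j * fact j * of_nat (x choose j))"
      using x by (intro sum.mono_neutral_right) auto
    finally show ?thesis using zeros that Y by auto
  qed
  have inj: "inj_on (of_nat :: nat \<Rightarrow> 'a) Y"
    by (simp add: inj_on_def)
  have "h = 0"
  proof (rule ccontr)
    assume "h \<noteq> 0"
    have "degree h \<le> J" using r(2) by (intro degree_le) (auto simp: h_coeff Suc_le_eq)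
    moreover have "card (of_nat ` Y :: 'a set) \<le> card {x. poly h x = 0}"
      using root \<open>h \<noteq> 0\<close> by (intro card_mono poly_roots_finite) auto
    moreover have "card {x. poly h x = 0} \<le> degree h" by (rule card_poly_roots_bound) fact
    ultimately show False using Y(2) inj by (simp add: card_image)
  qed
  \<comment> \<open>Comparing coefficients at degree \<open>J\<close> and dividing by
    \<open>a J\<close> would put -1 into the maximal ideal.\<close>
  then have "0 = (\<Sum>j\<le>n. a j * of_int (poly.coeff (r j) J))" using h_coeff[of J] by simp
  also have "\<dots> = (\<Sum>j\<in>insert J {J<..n}. a j * of_int (poly.coeff (r j) J))"
  proof (rule sum.mono_neutral_right)
    show "insert J {J<..n} \<subseteq> {..n}" by (auto simp: n_def)
    show "\<forall>j\<in>{..n} - insert J {J<..n}. a j * of_int (poly.coeff (r j) J) = 0"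
      using r(3) by (auto simp: coeff_eq_0 degree_falling_poly)
  qed simp
  also have "\<dots> = a J + (\<Sum>j\<in>{J<..n}. a j * of_int (poly.coeff (r j) J))"
    using r(3)[of J] lead_coeff_falling_poly[of J] by (simp add: degree_falling_poly)
  finally have "- 1 = (\<Sum>j\<in>{J<..n}. a j / a J * of_int (poly.coeff (r j) J))"
    using \<open>a J \<noteq> 0\<close> by (simp add: field_simps add_eq_0_iff flip: sum_divide_distrib)
  also have "\<dots> \<in> nonunits"
    by (intro nonunits_sum nonunits_mult small of_int_mem) auto
  finally show False using nonunits_minus one_notin_nonunits by fastforce
qed

text \<open>By Bezout u z + v p = 1, so if \<open>z\<close> lay in the maximal ideal, 1 would lie
  there too.\<close>

lemma inverse_of_int_mem:
  assumes "\<not> int p dvd z"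
  shows "inverse (of_int z) \<in> V"
proof -
  have "coprime z (int p)" using assms prime_p
    by (metis coprime_commute prime_imp_coprime prime_nat_int_transfer)
  then obtain u v where "u * z + v * int p = 1" by (metis coprime_iff_gcd_eq_1 bezout_int)
  then have "of_int u * of_int z + of_int v * of_nat p = (1 :: 'a)"
    by (metis of_int_1 of_int_add of_int_mult of_int_of_nat_eq)
  moreover have "of_int z \<notin> nonunits"
  proof
    assume "of_int z \<in> nonunits"
    then have "of_int z * of_int u + of_nat p * of_int v \<in> nonunits"
      by (intro nonunits_add nonunits_mult p_nonunit of_int_mem)
    then show False using calculation one_notin_nonunits by (simp add: mult.commute)
  qed
  ultimately show ?thesis using notin_nonunits_iff[OF of_int_mem] by blast
qed

lemma int_in_nonunits: "of_int z \<in> nonunits \<Longrightarrow> int p dvd z"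
  using inverse_of_int_mem[of z] by (auto simp: nonunits_def)

text \<open>The exponent of \<open>p\<close> in j! is below j/2 \<le> j - i, so at least one factor
  \<open>p\<close> survives; the part of j! prime to \<open>p\<close> is invertible in
  \<open>V\<close>.\<close>

lemma p_power_div_fact:
  assumes "p > 2" "2 * i \<le> j" "j > 0"
  shows "of_nat p ^ (j - i) / fact j \<in> nonunits"
proof -
  define v where "v = multiplicity p (fact j :: nat)"
  have "\<not> is_unit p" "(fact j :: nat) \<noteq> 0" using prime_p by auto
  then obtain u where u: "fact j = p ^ v * u" "\<not> p dvd u"
    unfolding v_def by (metis multiplicity_decompose')
  have "2 * v < j" unfolding v_def using prime_p assms by (intro multiplicity_fact_less)
  then obtain k where k: "j - i = v + Suc k" using assms(2)
    by (intro that[of "j - i - v - 1"]) linarith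
  have "(fact j :: 'a) = of_nat (fact j)" by simp
  then have "of_nat p ^ (j - i) / fact j = (of_nat p :: 'a) * (of_nat p ^ k * inverse (of_nat u))"
    using prime_p by (simp add: u k power_add field_simps)
  moreover have "inverse (of_nat u :: 'a) \<in> V"
    using inverse_of_int_mem[of "int u"] u(2) by simp
  ultimately show ?thesis by (auto intro: nonunits_mult p_nonunit mult_mem power_mem of_nat_mem)
qed

text \<open>An exponential sum \<open>\<Sum>i. \<kappa> i (1 + p \<delta> i)^x\<close> has the Newton expansion
  \<open>\<Sum>j. t j p^j (x choose j)\<close>, where the moments \<open>t j = \<Sum>i. \<kappa> i (\<delta> i)^j\<close> satisfy a monic
  recurrence over \<open>V\<close>, so that the first few of them dominate all others.\<close>

theorem exponential_sum_zeros:
  fixes \<kappa> \<delta> :: "'i \<Rightarrow> 'a" and X :: "nat set"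
  assumes "p > 2" and I: "finite I" "card I \<ge> 2" and \<delta>: "\<And>i. i \<in> I \<Longrightarrow> \<delta> i \<in> V"
    and h: "\<And>x. h x = (\<Sum>i\<in>I. \<kappa> i * (1 + of_nat p * \<delta> i) ^ x)"
    and nz: "\<exists>x. h x \<noteq> 0"
    and "finite X" and zeros: "\<And>x. x \<in> X \<Longrightarrow> h x = 0"
  shows "card X < 2 * (card I - 1)"
proof -
  define s where "s = card I"
  define t where "t = (\<lambda>j. \<Sum>i\<in>I. \<kappa> i * \<delta> i ^ j)"
  have newton: "h x = (\<Sum>j\<le>x. t j * of_nat p ^ j * of_nat (x choose j))" for x
  proof -
    have "h x = (\<Sum>i\<in>I. \<Sum>j\<le>x. \<kappa> i * (of_nat (x choose j) * (of_nat p * \<delta> i) ^ j))"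
      unfolding h by (subst add.commute, subst binomial_ring) (simp add: sum_distrib_left)
    then show ?thesis
      by (subst (asm) sum.swap)
        (simp add: t_def sum_distrib_right sum_distrib_left power_mult_distrib mult_ac)
  qed
  \<comment> \<open>The characteristic polynomial of the recurrence: it annihilates each sequence of
    powers of \<delta>, hence the moments \<open>t\<close>.\<close>
  define P where "P = (\<Prod>i\<in>I. [:- \<delta> i, 1:])"
  have P: "lead_coeff P = 1" "degree P = s" "\<And>l. poly.coeff P l \<in> V"
    unfolding P_def s_def using I \<delta> lead_coeff_prod[of "\<lambda>i. [:- \<delta> i, 1:]" I]
    by (auto simp: degree_prod_eq_sum_degree coeff_pCons
        intro!: coeff_prod_mem minus_mem one_mem zero_mem split: nat.splits)
  have rec: "t (j + s) = - (\<Sum>l<s. poly.coeff P l * t (j + l))" for j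
  proof -
    have "(\<Sum>l\<le>s. poly.coeff P l * t (j + l)) = (\<Sum>i\<in>I. \<kappa> i * \<delta> i ^ j * poly P (\<delta> i))"
      unfolding t_def sum_distrib_left poly_altdef P(2)
      by (subst sum.swap) (simp add: power_add mult_ac)
    also have "\<dots> = 0"
      unfolding P_def poly_prod using I(1) by (intro sum.neutral) (auto simp: prod_zero_iff)
    finally have "(\<Sum>l<s. poly.coeff P l * t (j + l)) + t (j + s) = 0"
      using P(1,2) by (simp flip: lessThan_Suc_atMost)
    then show ?thesis by (simp add: eq_neg_iff_add_eq_0 add.commute)
  qed
  have "\<exists>j<s. t j \<noteq> 0"
  proof (rule ccontr)
    assume "\<not> (\<exists>j<s. t j \<noteq> 0)"
    then have small: "t j = 0" if "j < s" for j using that by blast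
    have "t j = 0" for j
    proof (induction j rule: less_induct)
      case (less j)
      show ?case
      proof (cases "j < s")
        case False
        then obtain j' where j: "j = j' + s" by (metis add.commute le_Suc_ex not_less)
        then show ?thesis using less.IH by (simp add: rec)
      qed (rule small)
    qed
    then show False using nz newton by simp
  qed
  then obtain i0 where i0: "i0 < s" "t i0 \<noteq> 0" and i0_div: "\<And>l. l < s \<Longrightarrow> t l / t i0 \<in> V"
    using exists_dividing_all[of "{..<s}" _ t] by (metis finite_lessThan lessThan_iff)
  have tV: "t j / t i0 \<in> V" for j
  proof (induction j rule: less_induct)
    case (less j)
    show ?case
    proof (cases "j < s")
      case False
      then obtain j' where j: "j = j' + s" by (metis add.commute le_Suc_ex not_less)
      then have "t j / t i0 = - (\<Sum>l<s. poly.coeff P l * (t (j' + l) / t i0))"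
        by (simp add: rec sum_divide_distrib)
      also have "\<dots> \<in> V" using less.IH j P(3) by (intro minus_mem sum_mem mult_mem) auto
      finally show ?thesis .
    qed (rule i0_div)
  qed
  \<comment> \<open>Coefficients with respect to falling factorials, the form required by
    \<open>newton_series_zeros\<close>.\<close>
  define a where "a = (\<lambda>j. t j * of_nat p ^ j / fact j)"
  have p0: "(of_nat p :: 'a) \<noteq> 0" using prime_p by auto
  \<comment> \<open>As i0 \<le> s - 1, every j \<ge> L satisfies 2 i0 \<le> j, so
    \<open>p_power_div_fact\<close> controls the tail; s \<ge> 2 gives i0 < L. The dominant index
    \<open>J\<close> is therefore sought below \<open>L\<close>.\<close>
  define L where "L = 2 * (s - 1)"
  have s2: "s \<ge> 2" using I(2) by (simp add: s_def)
  have "\<exists>J\<in>{..<L}. a J \<noteq> 0 \<and> (\<forall>l\<in>{..<L}. a l / a J \<in> V \<and> (J < l \<longrightarrow> a l / a J \<in> nonunits))"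
    using i0 s2 p0 by (intro exists_dividing_all[of _ i0]) (auto simp: a_def L_def)
  then obtain J where J: "J < L" "a J \<noteq> 0" "\<And>l. l < L \<Longrightarrow> a l / a J \<in> V"
    "\<And>l. l < L \<Longrightarrow> J < l \<Longrightarrow> a l / a J \<in> nonunits"
    by auto
  have "card X \<le> J"
  proof (rule newton_series_zeros[of a J X])
    show "a j / a J \<in> nonunits" if "j > J" for j
    proof (cases "j < L")
      case False
      \<comment> \<open>In the tail, \<open>a j\<close> is compared with \<open>a J\<close> through
        \<open>a i0\<close>.\<close>
      have ai0: "a i0 \<noteq> 0" using i0 p0 by (simp add: a_def)
      have j: "2 * i0 \<le> j" "j > 0" using False i0 s2 by (auto simp: L_def)
      have "of_nat p ^ j = (of_nat p ^ (j - i0) * of_nat p ^ i0 :: 'a)"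
        using j by (simp flip: power_add)
      then have "a j / a i0 = of_nat p ^ (j - i0) / fact j * (t j / t i0 * of_nat (fact i0))"
        using p0 i0 by (simp add: a_def field_simps)
      also have "\<dots> \<in> nonunits"
        using p_power_div_fact[OF \<open>p > 2\<close> j] by (intro nonunits_mult mult_mem tV of_nat_mem)
      finally have "a j / a i0 * (a i0 / a J) \<in> nonunits"
        using i0 s2 by (intro nonunits_mult J(3)) (auto simp: L_def)
      then show ?thesis using ai0 by simp
    qed (use J that in auto)
    show "(\<Sum>j\<le>x. a j * fact j * of_nat (x choose j)) = 0" if "x \<in> X" for x
      using zeros[OF that] by (simp add: newton a_def)
  qed (use J \<open>finite X\<close> in auto)
  then show ?thesis using J(1) by (simp add: L_def s_def)
qed

end

section \<open>Units and roots of unity\<close>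

abbreviation ceval :: "int poly \<Rightarrow> complex \<Rightarrow> complex" where
  "ceval f \<equiv> poly (map_poly of_int f)"

lemma ceval_altdef: "ceval f z = (\<Sum>i\<le>degree f. of_int (poly.coeff f i) * z ^ i)"
proof -
  have "degree (map_poly complex_of_int f) = degree f" by (rule degree_map_poly) simp
  then show ?thesis by (simp add: poly_altdef coeff_map_poly)
qed

lemma ceval_simps:
  "ceval (f + g) z = ceval f z + ceval g z" "ceval (f - g) z = ceval f z - ceval g z"
  "ceval (f * g) z = ceval f z * ceval g z" "ceval (Polynomial.monom a i) z = of_int a * z ^ i"
  "ceval 1 z = 1"
proof -
  have "map_poly complex_of_int (f + g) = map_poly of_int f + map_poly of_int g"
    "map_poly complex_of_int (f - g) = map_poly of_int f - map_poly of_int g"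
    "map_poly complex_of_int (f * g) = map_poly of_int f * map_poly of_int g"
    by (rule poly_eqI, simp add: coeff_map_poly coeff_mult)+
  then show "ceval (f + g) z = ceval f z + ceval g z" "ceval (f - g) z = ceval f z - ceval g z"
    "ceval (f * g) z = ceval f z * ceval g z"
    by simp_all
qed (simp_all add: map_poly_monom poly_monom)

lemma int_poly_eq_0_if_roots_unity:
  fixes r :: "int poly"
  assumes "m > 0" "\<forall>i\<ge>m. poly.coeff r i = 0" "\<And>z. z ^ m = 1 \<Longrightarrow> ceval r z = 0"
  shows "r = 0"
proof (rule ccontr)
  define R where "R = map_poly complex_of_int r"
  assume "r \<noteq> 0"
  then have "R \<noteq> 0" unfolding R_def by (subst map_poly_eq_0_iff) auto
  have "card {z::complex. z ^ m = 1} \<le> card {z. poly R z = 0}"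
    using assms(3) \<open>R \<noteq> 0\<close> by (intro card_mono poly_roots_finite) (auto simp: R_def)
  also have "\<dots> \<le> degree R" using \<open>R \<noteq> 0\<close> by (rule card_poly_roots_bound)
  also have "degree R = degree r" unfolding R_def by (rule degree_map_poly) simp
  also have "degree r < m"
    using assms(2) \<open>r \<noteq> 0\<close> by (metis leading_coeff_0_iff not_less)
  finally show False using card_roots_unity_eq[OF \<open>m > 0\<close>] by simp
qed

text \<open>A remainder of degree below \<open>m\<close> that vanishes at all \<open>m\<close> roots
  of unity is zero. Divisibility over the integers thus becomes a condition at complex
  points.\<close>

lemma monom_minus_1_dvd_iff:
  fixes p :: "int poly"
  assumes "m > 0"
  shows "(Polynomial.monom 1 m - 1) dvd p \<longleftrightarrow> (\<forall>z. z ^ m = 1 \<longrightarrow> ceval p z = 0)"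
proof
  have root: "ceval q z = 0" if "(Polynomial.monom 1 m - 1) dvd q" "z ^ m = 1" for q z
    using that by (auto elim!: dvdE simp: ceval_simps)
  then show "\<forall>z. z ^ m = 1 \<longrightarrow> ceval p z = 0" if "(Polynomial.monom 1 m - 1) dvd p"
    using that by blast
  assume p: "\<forall>z. z ^ m = 1 \<longrightarrow> ceval p z = 0"
  obtain r where r: "\<forall>i\<ge>m. poly.coeff r i = 0" "(Polynomial.monom 1 m - 1) dvd p - r"
    using cong_monom_minus_1[OF assms] by blast
  have "ceval r z = 0" if "z ^ m = 1" for z
    using root[OF r(2) that] p that by (simp add: ceval_simps)
  then have "r = 0"
    using r(1) assms by (intro int_poly_eq_0_if_roots_unity[of m])
  then show "(Polynomial.monom 1 m - 1) dvd p" using r(2) by simp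
qed

lemma unit_iff_inverse_at_roots_unity:
  assumes "m > 0"
  shows "defines_unit_on_order f m \<longleftrightarrow> (\<exists>g. \<forall>z. z ^ m = 1 \<longrightarrow> ceval f z * ceval g z = 1)"
  unfolding defines_unit_on_order_iff_quotient[OF assms] monom_minus_1_dvd_iff[OF assms]
  by (simp add: ceval_simps)

text \<open>The same inverse serves, since the l-th roots of unity are among the m-th.\<close>

lemma defines_unit_on_divisor:
  assumes "defines_unit_on_order f m" "l dvd m" "m > 0"
  shows "defines_unit_on_order f l"
proof -
  have "l > 0" using assms by (auto intro: Nat.gr0I)
  moreover have "z ^ m = 1" if "z ^ l = 1" for z :: complex
    using assms(2) that by (auto elim!: dvdE simp: power_mult)
  ultimately show ?thesis using assms unit_iff_inverse_at_roots_unity by blast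
qed

text \<open>The matrix of multiplication by \<open>f\<close> on Z[X]/(X^m - 1) in the basis of
  powers of X; column \<open>j\<close> is the image of X^j.\<close>

definition circulant :: "nat \<Rightarrow> int poly \<Rightarrow> int mat" where
  "circulant m f = Matrix.mat m m (\<lambda>(i, j). \<Sum>l | l \<le> degree f \<and> (l + j) mod m = i. poly.coeff f l)"

lemma circulant_carrier [simp]: "circulant m f \<in> carrier_mat m m"
  by (simp add: circulant_def)

text \<open>Evaluation at an m-th root of unity is a ring homomorphism on Z[X]/(X^m - 1), so the row
  of powers of \<open>z\<close> is a left eigenvector with eigenvalue f(z).\<close>

lemma circulant_eigenvector:
  assumes "z ^ m = 1" "j < m"
  shows "(\<Sum>i<m. z ^ i * of_int (circulant m f $$ (i, j))) = ceval f z * z ^ j"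
proof -
  have zmod: "z ^ (n mod m) = z ^ n" for n
  proof -
    have "z ^ n = z ^ (m * (n div m) + n mod m)" by simp
    then show ?thesis using assms(1) by (simp only: power_add power_mult) simp
  qed
  have "(\<Sum>i<m. z ^ i * of_int (circulant m f $$ (i, j))) =
      (\<Sum>i<m. \<Sum>l\<in>{l\<in>{..degree f}. (l + j) mod m = i}. z ^ ((l + j) mod m) * of_int (poly.coeff f l))"
    using assms(2) by (auto simp: circulant_def sum_distrib_left intro!: sum.cong)
  also have "\<dots> = (\<Sum>l\<le>degree f. z ^ ((l + j) mod m) * of_int (poly.coeff f l))"
    using assms(2) by (intro sum.group) auto
  also have "\<dots> = ceval f z * z ^ j"
    by (simp add: zmod ceval_altdef power_add sum_distrib_left mult_ac)
  finally show ?thesis .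
qed

lemma sum_powers_root_unity:
  fixes z :: complex
  assumes "z ^ m = 1" "z \<noteq> 1"
  shows "(\<Sum>i<m. z ^ i) = 0"
  using assms by (simp add: sum_gp_strict)

text \<open>The Vandermonde matrix \<open>U\<close> of the roots of unity diagonalises the
  circulant; it is invertible because U W is \<open>m\<close> times the identity. In particular the
  product is an integer.\<close>

lemma det_circulant:
  assumes "m > 0"
  shows "of_int (det (circulant m f)) = (\<Prod>z | z ^ m = 1. ceval f z)"
proof -
  obtain \<zeta> where \<zeta>: "bij_betw \<zeta> {..<m} {z::complex. z ^ m = 1}"
    using bij_betw_roots_unity[OF assms] by blast
  then have \<zeta>1: "\<zeta> k ^ m = 1" if "k < m" for k using that by (auto simp: bij_betw_def)
  define U where "U = Matrix.mat m m (\<lambda>(k, i). \<zeta> k ^ i)"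
  define W where "W = Matrix.mat m m (\<lambda>(i, k). inverse (\<zeta> k) ^ i)"
  define C where "C = map_mat complex_of_int (circulant m f)"
  define D where "D = mat_diag m (\<lambda>k. ceval f (\<zeta> k))"
  have carrier [simp]: "U \<in> carrier_mat m m" "W \<in> carrier_mat m m" "C \<in> carrier_mat m m" "D \<in> carrier_mat m m"
    by (auto simp: U_def W_def C_def D_def)
  have UC: "U * C = D * U"
  proof (rule eq_matI)
    fix k j assume "k < dim_row (D * U)" "j < dim_col (D * U)"
    then have kj: "k < m" "j < m" by (auto simp: D_def U_def mat_diag_def)
    have "(U * C) $$ (k, j) = (\<Sum>i<m. \<zeta> k ^ i * of_int (circulant m f $$ (i, j)))"
      using kj by (simp add: U_def C_def scalar_prod_def circulant_def atLeast0LessThan)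
    also have "\<dots> = ceval f (\<zeta> k) * \<zeta> k ^ j" by (rule circulant_eigenvector) (use kj \<zeta>1 in auto)
    also have "\<dots> = (D * U) $$ (k, j)"
      using kj unfolding D_def by (subst mat_diag_mult_left[of _ m m]) (auto simp: U_def)
    finally show "(U * C) $$ (k, j) = (D * U) $$ (k, j)" .
  qed (auto simp: U_def D_def C_def circulant_def mat_diag_def)
  have "U * W = of_nat m \<cdot>\<^sub>m 1\<^sub>m m"
  proof (rule eq_matI)
    fix k l assume "k < dim_row (of_nat m \<cdot>\<^sub>m 1\<^sub>m m :: complex mat)" "l < dim_col (of_nat m \<cdot>\<^sub>m 1\<^sub>m m :: complex mat)"
    then have kl: "k < m" "l < m" by auto
    have nz: "\<zeta> l \<noteq> 0" using \<zeta>1[OF kl(2)] assms by (metis power_eq_0_iff zero_neq_one)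
    have "(U * W) $$ (k, l) = (\<Sum>i<m. (\<zeta> k / \<zeta> l) ^ i)"
      using kl by (simp add: U_def W_def scalar_prod_def atLeast0LessThan power_divide field_simps)
    also have "\<dots> = (if k = l then of_nat m else 0)"
    proof (cases "k = l")
      case False
      then have "\<zeta> k \<noteq> \<zeta> l" using \<zeta> kl by (auto simp: bij_betw_def inj_on_def)
      then show ?thesis using False nz kl \<zeta>1
          sum_powers_root_unity[of "\<zeta> k / \<zeta> l" m] by (simp add: power_divide)
    qed (use nz in simp)
    finally show "(U * W) $$ (k, l) = (of_nat m \<cdot>\<^sub>m 1\<^sub>m m :: complex mat) $$ (k, l)" using kl by simp
  qed (auto simp: U_def W_def)
  then have "det (U * W) = of_nat m ^ m" by simp
  then have "det U \<noteq> 0" using assms by (auto simp: det_mult[of _ m])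
  moreover have "det U * det C = det D * det U"
    using arg_cong[OF UC, of det] by (simp add: det_mult[of _ m])
  ultimately have "det C = det D" by simp
  also have "det D = (\<Prod>k<m. ceval f (\<zeta> k))"
    by (subst det_upper_triangular[of _ m])
       (auto simp: D_def mat_diag_def upper_triangular_def prod_list_diag_prod atLeast0LessThan)
  also have "\<dots> = (\<Prod>z | z ^ m = 1. ceval f z)"
    using prod.reindex_bij_betw[OF \<zeta>] by simp
  finally show ?thesis by (simp add: C_def)
qed

text \<open>The product is the norm of \<open>f\<close>, a determinant over the integers. Norms are
  multiplicative, so a unit has norm 1 or -1; conversely the adjugate matrix provides an
  inverse.\<close>

lemma defines_unit_iff_prod:
  assumes "m > 0"
  shows "defines_unit_on_order f m \<longleftrightarrow> (\<Prod>z | z ^ m = 1. ceval f z) \<in> {1, - 1}"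
proof
  assume "defines_unit_on_order f m"
  then obtain g where g: "\<And>z. z ^ m = 1 \<Longrightarrow> ceval f z * ceval g z = 1"
    using unit_iff_inverse_at_roots_unity[OF assms] by blast
  have "complex_of_int (det (circulant m f) * det (circulant m g)) = 1"
    unfolding of_int_mult det_circulant[OF assms] prod.distrib[symmetric] using g by simp
  then have "det (circulant m f) * det (circulant m g) = 1" by (metis of_int_eq_1_iff)
  then have "det (circulant m f) = 1 \<or> det (circulant m f) = - 1" using zmult_eq_1_iff by blast
  then show "(\<Prod>z | z ^ m = 1. ceval f z) \<in> {1, - 1}"
    unfolding det_circulant[OF assms, symmetric] by auto
next
  define s where "s = det (circulant m f)"
  assume "(\<Prod>z | z ^ m = 1. ceval f z) \<in> {1, - 1}"
  then have "complex_of_int s = of_int 1 \<or> complex_of_int s = of_int (- 1)"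
    unfolding s_def det_circulant[OF assms] by simp
  then have s: "s * s = 1" unfolding of_int_eq_iff by auto
  define A where "A = adj_mat (circulant m f)"
  note A = adj_mat[OF circulant_carrier[of m f], folded A_def s_def]
  \<comment> \<open>The first column of the inverse matrix \<open>s * A\<close>, that is, the
    preimage of the basis element 1 under multiplication by \<open>f\<close>.\<close>
  define g where "g = (\<Sum>j<m. Polynomial.monom (s * A $$ (j, 0)) j)"
  have CA: "(\<Sum>j<m. circulant m f $$ (i, j) * A $$ (j, 0)) = (if i = 0 then s else 0)" if "i < m" for i
  proof -
    have "(circulant m f * A) $$ (i, 0) = (\<Sum>j<m. circulant m f $$ (i, j) * A $$ (j, 0))"
      using that A(1) assms by (simp add: scalar_prod_def circulant_def atLeast0LessThan)
    moreover have "(circulant m f * A) $$ (i, 0) = (if i = 0 then s else 0)"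
      unfolding A(2) using that by auto
    ultimately show ?thesis by simp
  qed
  have "ceval f z * ceval g z = 1" if z: "z ^ m = 1" for z
  proof -
    have "ceval g z = (\<Sum>j<m. of_int (s * A $$ (j, 0)) * z ^ j)"
      unfolding g_def by (induction m) (simp_all add: ceval_simps)
    then have "ceval f z * ceval g z = (\<Sum>j<m. ceval f z * z ^ j * of_int (s * A $$ (j, 0)))"
      by (simp add: sum_distrib_left mult_ac)
    also have "\<dots> = (\<Sum>j<m. \<Sum>i<m. z ^ i * of_int (circulant m f $$ (i, j)) * of_int (s * A $$ (j, 0)))"
      using circulant_eigenvector[OF z, of _ f] by (simp flip: sum_distrib_right)
    also have "\<dots> = (\<Sum>i<m. z ^ i * of_int s * of_int (\<Sum>j<m. circulant m f $$ (i, j) * A $$ (j, 0)))"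
      by (subst sum.swap) (simp add: sum_distrib_left mult_ac)
    also have "\<dots> = (\<Sum>i<m. if i = 0 then of_int (s * s) else 0)"
      by (rule sum.cong) (auto simp: CA)
    also have "\<dots> = 1" using assms s by simp
    finally show ?thesis .
  qed
  then show "defines_unit_on_order f m" using unit_iff_inverse_at_roots_unity[OF assms] by blast
qed

text \<open>The factorization of X^m - 1, evaluated at \<open>a\<close>: the difference of both
  sides has degree below \<open>m\<close> and \<open>m\<close> zeros.\<close>

lemma prod_roots_unity_minus:
  fixes a :: complex
  assumes "m > 0"
  shows "(\<Prod>z | z ^ m = 1. z - a) = (- 1) ^ m * (a ^ m - 1)"
proof -
  define R where "R = {z::complex. z ^ m = 1}"
  have R: "finite R" "card R = m"
    unfolding R_def using finite_roots_unity[of m] card_roots_unity_eq[of m] assms by auto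
  define P where "P = (\<Prod>z\<in>R. [:- z, 1:])"
  have P: "lead_coeff P = 1" "degree P = m"
    unfolding P_def using R lead_coeff_prod[of "\<lambda>z. [:- z, 1:]" R]
    by (simp_all add: degree_prod_eq_sum_degree)
  define Q where "Q = Polynomial.monom 1 m - 1 - P"
  have "Q = 0"
  proof (rule ccontr)
    assume "Q \<noteq> 0"
    have "poly Q z = 0" if "z \<in> R" for z
      using that R(1) by (auto simp: Q_def P_def poly_monom poly_prod R_def intro: prod_zero)
    then have "m \<le> card {z. poly Q z = 0}"
      using R \<open>Q \<noteq> 0\<close> card_mono[of "{z. poly Q z = 0}" R] poly_roots_finite by auto
    also have "\<dots> \<le> degree Q" using \<open>Q \<noteq> 0\<close> by (rule card_poly_roots_bound)
    also have "degree Q < m"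
    proof -
      have "poly.coeff Q i = 0" if "i \<ge> m" for i
        using that P assms by (cases "i = m") (auto simp: Q_def coeff_eq_0)
      then show ?thesis using \<open>Q \<noteq> 0\<close> by (metis leading_coeff_0_iff not_less)
    qed
    finally show False by simp
  qed
  then have "poly P a = a ^ m - 1" by (simp add: Q_def poly_monom) (metis diff_eq_eq diff_zero poly_1 poly_diff poly_monom mult_1 eq_iff_diff_eq_0)
  then have "(\<Prod>z\<in>R. a - z) = a ^ m - 1" by (simp add: P_def poly_prod)
  moreover have "(\<Prod>z\<in>R. z - a) = (\<Prod>z\<in>R. (- 1) * (a - z))" by (intro prod.cong) auto
  ultimately show ?thesis
    using R(2) unfolding prod.distrib R_def[symmetric] by (simp only: prod_constant)
qed

text \<open>Up to sign, the product below is the resultant of \<open>f\<close> and \<open>X^m - 1\<close>.\<close>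

lemma defines_unit_iff_roots:
  fixes \<alpha> :: "nat \<Rightarrow> complex"
  assumes "m > 0"
    and f: "\<And>z. ceval f z = of_int c * z ^ d * (\<Prod>i<N. z - \<alpha> i)"
  shows "defines_unit_on_order f m \<longleftrightarrow> of_int c ^ m * (\<Prod>i<N. \<alpha> i ^ m - 1) \<in> {1, - 1}"
proof -
  define R where "R = {z::complex. z ^ m = 1}"
  have R: "finite R" "card R = m"
    unfolding R_def using finite_roots_unity[of m] card_roots_unity_eq[of m] assms by auto
  have minus: "(\<Prod>z\<in>R. z - a) = (- 1) ^ m * (a ^ m - 1)" for a
    unfolding R_def by (rule prod_roots_unity_minus) fact
  define e :: complex where "e = (- 1) ^ (m + 1)"
  have e: "\<Prod>R = e"
    using minus[of 0] assms by (simp add: e_def power_0_left)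
  have "(\<Prod>z\<in>R. ceval f z) = of_int c ^ m * \<Prod>R ^ d * (\<Prod>z\<in>R. \<Prod>i<N. z - \<alpha> i)"
    by (simp add: f prod.distrib R flip: prod_power_distrib)
  also have "(\<Prod>z\<in>R. \<Prod>i<N. z - \<alpha> i) = (\<Prod>i<N. (- 1) ^ m * (\<alpha> i ^ m - 1))"
    by (subst prod.swap) (simp add: minus)
  finally have "(\<Prod>z\<in>R. ceval f z) = e ^ d * ((- 1) ^ m) ^ N * (of_int c ^ m * (\<Prod>i<N. \<alpha> i ^ m - 1))"
    by (simp add: prod.distrib e)
  moreover have "e ^ d * ((- 1) ^ m) ^ N \<in> {1, - 1}"
    unfolding e_def power_mult[symmetric] power_add[symmetric]
    by (simp add: minus_one_power_iff)
  ultimately show ?thesis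
    unfolding defines_unit_iff_prod[OF assms(1)] R_def[symmetric] by (auto simp: minus_equation_iff)
qed

section \<open>Counting the orders in residue classes\<close>

lemma ceval_upper:
  assumes "\<forall>i\<ge>n. poly.coeff q i = 0"
  shows "ceval q z = (\<Sum>i<n. of_int (poly.coeff q i) * z ^ i)"
proof -
  have "ceval q z = (\<Sum>i\<in>{..degree q} \<inter> {..<n}. of_int (poly.coeff q i) * z ^ i)"
    unfolding ceval_altdef using assms by (intro sum.mono_neutral_right) (auto simp: not_less)
  also have "\<dots> = (\<Sum>i<n. of_int (poly.coeff q i) * z ^ i)"
    by (intro sum.mono_neutral_left) (auto simp: coeff_eq_0)
  finally show ?thesis .
qed

text \<open>Extend the subring of integers, which contains \<open>p\<close> but not 1/p.\<close>

lemma p_valuation_ring_exists: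
  assumes "prime p"
  shows "\<exists>V :: 'a :: field_char_0 set. p_valuation_ring V p"
proof -
  have "inverse (of_nat p) \<notin> (\<int> :: 'a set)"
  proof
    assume "inverse (of_nat p) \<in> (\<int> :: 'a set)"
    then obtain z where "inverse (of_nat p :: 'a) = of_int z" by (auto elim: Ints_cases)
    then have "(of_int (int p * z) :: 'a) = of_int 1"
      using assms by (simp flip: \<open>inverse (of_nat p) = of_int z\<close>)
    then have "int p * z = 1" by (simp only: of_int_eq_iff)
    then have "int p dvd 1" by (metis dvd_triv_left)
    then show False using assms by simp
  qed
  moreover have "subring_of_field (\<int> :: 'a set)" by unfold_locales auto
  ultimately obtain V :: "'a set" where V: "valuation_ring V" "\<int> \<subseteq> V" "inverse (of_nat p) \<notin> V"
    using valuation_ring_exists[of \<int> "of_nat p"] by auto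
  then have "of_nat p \<in> valuation_ring.nonunits V"
    by (auto simp: valuation_ring.nonunits_def)
  then show ?thesis
    using V(1) assms by (intro exI[of _ V]) (simp add: p_valuation_ring_def p_valuation_ring_axioms_def)
qed

section \<open>Elements congruent to 1 modulo p\<close>

context p_valuation_ring
begin

text \<open>Congruence is modulo \<open>p\<close> itself and not only modulo the maximal ideal, so
  that (b - 1)/p lies in \<open>V\<close> as \<open>exponential_sum_zeros\<close> requires.\<close>

definition one_units :: "'a set" where
  "one_units = {1 + of_nat p * y | y. y \<in> V}"

lemma one_in_one_units: "1 \<in> one_units"
  unfolding one_units_def using zero_mem by force

lemma one_units_mult: "x \<in> one_units \<Longrightarrow> y \<in> one_units \<Longrightarrow> x * y \<in> one_units"
proof -
  assume "x \<in> one_units" "y \<in> one_units"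
  then obtain u v where "u \<in> V" "v \<in> V" "x = 1 + of_nat p * u" "y = 1 + of_nat p * v"
    by (auto simp: one_units_def)
  then show ?thesis
    unfolding one_units_def
    by (intro CollectI exI[of _ "u + v + of_nat p * u * v"])
       (auto simp: algebra_simps intro!: add_mem mult_mem of_nat_mem)
qed

lemma one_units_power: "x \<in> one_units \<Longrightarrow> x ^ n \<in> one_units"
  by (induction n) (auto intro: one_in_one_units one_units_mult)

lemma one_units_prod: "(\<And>i. i \<in> A \<Longrightarrow> f i \<in> one_units) \<Longrightarrow> prod f A \<in> one_units"
  by (induction A rule: infinite_finite_induct) (auto intro: one_in_one_units one_units_mult)

lemma one_units_diff_1: "x \<in> one_units \<Longrightarrow> x - 1 \<in> nonunits"
  unfolding one_units_def using nonunits_mult[OF p_nonunit] by auto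

text \<open>Fermat's little theorem; \<open>p - 1\<close> is even, so \<open>c\<close> may be
  replaced by its absolute value.\<close>

lemma of_int_power_in_one_units:
  assumes "p > 2" "\<not> int p dvd c"
  shows "of_int c ^ (p - 1) \<in> one_units"
proof -
  have "odd p" using assms prime_p prime_odd_nat by blast
  then have "c ^ (p - 1) = int (nat \<bar>c\<bar> ^ (p - 1))" by (simp add: power_even_abs)
  moreover have "[nat \<bar>c\<bar> ^ (p - 1) = 1] (mod p)"
    using assms(2) by (intro fermat_theorem prime_p) (simp add: nat_dvd_iff flip: int_dvd_int_iff)
  ultimately have "[c ^ (p - 1) = 1] (mod int p)" by (metis cong_int_iff of_nat_1)
  then obtain k where "c ^ (p - 1) = 1 + int p * k" by (metis add.commute cong_iff_lin cong_sym)
  then have "of_int c ^ (p - 1) = (1 + of_nat p * of_int k :: 'a)"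
    by (metis of_int_1 of_int_add of_int_mult of_int_of_nat_eq of_int_power)
  then show ?thesis using of_int_mem by (auto simp: one_units_def)
qed

end

text \<open>The exponent comes from two powers of \<open>X\<close> that agree modulo \<open>p\<close> and \<open>P\<close>: there are only
  \<open>p ^ degree P\<close> residues.\<close>

lemma roots_one_units_exponent:
  fixes V :: "complex set" and P :: "int poly"
  assumes "p_valuation_ring V p"
    and lc: "\<not> int p dvd lead_coeff P" and c0: "\<not> int p dvd poly.coeff P 0"
  shows "\<exists>e. 0 < e \<and> e \<le> p ^ degree P \<and>
    (\<forall>x. ceval P x = 0 \<longrightarrow> x \<in> V \<and> x ^ e \<in> p_valuation_ring.one_units V p)"
proof -
  interpret p_valuation_ring V p by fact
  define N where "N = degree P"
  have p0: "p > 0" using prime_p by (simp add: prime_gt_0_nat)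
  have xV: "x \<in> V" if "ceval P x = 0" for x
  proof -
    define Q where "Q = Polynomial.smult (inverse (of_int (lead_coeff P))) (map_poly complex_of_int P)"
    have "lead_coeff P \<noteq> 0" using lc by auto
    moreover have "degree (map_poly complex_of_int P) = N" unfolding N_def by (rule degree_map_poly) simp
    ultimately have "poly Q x = 0" "lead_coeff Q = 1"
      using that by (auto simp: Q_def coeff_map_poly N_def)
    moreover have "poly.coeff Q i \<in> V" for i
      unfolding Q_def using inverse_of_int_mem[OF lc] of_int_mem
      by (auto simp: coeff_map_poly intro!: mult_mem)
    ultimately show ?thesis by (rule integrally_closed)
  qed
  \<comment> \<open>The equation of \<open>x\<close> writes the constant coefficient, a unit of
    \<open>V\<close>, as a multiple of \<open>x\<close> in \<open>V\<close>.\<close>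
  have ixV: "x \<noteq> 0 \<and> inverse x \<in> V" if "ceval P x = 0" for x
  proof -
    have "0 = (\<Sum>i\<le>N. of_int (poly.coeff P i) * x ^ i)" using that by (simp add: ceval_altdef N_def)
    also have "\<dots> = of_int (poly.coeff P 0) + x * (\<Sum>i<N. of_int (poly.coeff P (Suc i)) * x ^ i)"
      by (cases N) (simp_all add: sum.atMost_Suc_shift lessThan_Suc_atMost sum_distrib_left mult_ac del: sum.atMost_Suc)
    finally have eq: "of_int (poly.coeff P 0) = - (x * (\<Sum>i<N. of_int (poly.coeff P (Suc i)) * x ^ i))"
      (is "_ = - (x * ?s)") by (simp add: add_eq_0_iff)
    have "complex_of_int (poly.coeff P 0) \<noteq> 0" using c0 by auto
    with eq have x0: "x \<noteq> 0" by auto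
    have "inverse x = - ?s * inverse (of_int (poly.coeff P 0))"
      using eq x0 \<open>complex_of_int (poly.coeff P 0) \<noteq> 0\<close> by (simp add: field_simps)
    also have "\<dots> \<in> V"
      by (intro mult_mem minus_mem sum_mem power_mem of_int_mem xV that inverse_of_int_mem c0)
    finally show ?thesis using x0 by simp
  qed
  have "coprime (lead_coeff P) (int p)" using lc prime_p
    by (metis coprime_commute prime_imp_coprime prime_nat_int_transfer)
  then obtain c' where "[lead_coeff P * c' = 1] (mod int p)" using cong_solve_coprime_int by blast
  then obtain k where k: "lead_coeff P * c' = 1 + int p * k" by (metis add.commute cong_iff_lin cong_sym)
  \<comment> \<open>A monic integer polynomial congruent to c' P modulo \<open>p\<close>: division
    by it stays over the integers, and at the roots of \<open>P\<close> its value is a multiple of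
    \<open>p\<close>.\<close>
  define g where "g = Polynomial.smult c' P - Polynomial.smult (int p * k) (Polynomial.monom 1 N)"
  have gN: "poly.coeff g N = 1" using k by (simp add: g_def N_def mult.commute)
  have "degree g \<le> N" unfolding g_def by (intro degree_diff_le) (simp_all add: N_def degree_monom_le)
  moreover have "N \<le> degree g" using gN by (intro le_degree) simp
  ultimately have g: "degree g = N" "lead_coeff g = 1" using gN by auto
  have g_root: "ceval g x = - (of_nat p * of_int k * x ^ N)" if "ceval P x = 0" for x
  proof -
    have smult: "Polynomial.smult a q = Polynomial.monom a 0 * q" for a and q :: "int poly"
      by (simp add: monom_0)
    show ?thesis unfolding g_def smult using that by (simp add: ceval_simps)
  qed
  have "\<exists>r. (\<exists>q. Polynomial.monom 1 i = g * q + r) \<and> (\<forall>l\<ge>N. poly.coeff r l = 0)" for i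
    using monic_remainder[OF g(2), of "Polynomial.monom 1 i"] g(1) by auto
  then obtain r where r: "\<And>i. \<exists>q. Polynomial.monom 1 i = g * q + r i"
    "\<And>i. \<forall>l\<ge>N. poly.coeff (r i) l = 0" by metis
  have pow: "\<exists>y\<in>V. x ^ i = ceval (r i) x + of_nat p * y" if "ceval P x = 0" for x i
  proof -
    obtain q where "Polynomial.monom 1 i = g * q + r i" using r by blast
    then have "ceval (Polynomial.monom 1 i) x = ceval (g * q + r i) x" by simp
    then have "x ^ i = ceval g x * ceval q x + ceval (r i) x" by (simp add: ceval_simps)
    then have "x ^ i = ceval (r i) x + of_nat p * (- (of_int k * x ^ N * ceval q x))"
      unfolding g_root[OF that] by (simp add: algebra_simps)
    moreover have "- (of_int k * x ^ N * ceval q x) \<in> V"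
      unfolding ceval_altdef
      by (intro minus_mem mult_mem sum_mem power_mem of_int_mem xV that)
    ultimately show ?thesis by blast
  qed
  \<comment> \<open>The residue of X^i modulo \<open>p\<close> and \<open>g\<close>. There are p^N +
    1 exponents but only p^N residues, so two powers agree; their difference does not depend on the
    root \<open>x\<close>.\<close>
  define F where "F = (\<lambda>i. \<lambda>l\<in>{..<N}. poly.coeff (r i) l mod int p)"
  have "F ` {..p ^ N} \<subseteq> {..<N} \<rightarrow>\<^sub>E {0..<int p}" using p0 by (auto simp: F_def split: if_splits)
  moreover have "finite ({..<N} \<rightarrow>\<^sub>E {0..<int p})" by (intro finite_PiE) auto
  ultimately have "card (F ` {..p ^ N}) \<le> card ({..<N} \<rightarrow>\<^sub>E {0..<int p})" by (intro card_mono)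
  also have "\<dots> = p ^ N" by (simp add: card_PiE)
  finally have "\<not> inj_on F {..p ^ N}" by (intro pigeonhole) simp
  then obtain i' j' where "i' \<noteq> j'" "i' \<le> p ^ N" "j' \<le> p ^ N" "F i' = F j'" by (auto simp: inj_on_def)
  then obtain i j where ij: "i < j" "j \<le> p ^ N" "F i = F j" by (metis nat_neq_iff)
  have "x ^ (j - i) \<in> one_units" if x: "ceval P x = 0" for x
  proof -
    have "\<exists>d. poly.coeff (r j) l - poly.coeff (r i) l = int p * d" if "l < N" for l
    proof -
      have "F j l = F i l" using ij(3) by simp
      then have "poly.coeff (r j) l mod int p = poly.coeff (r i) l mod int p" using that by (simp add: F_def)
      then show ?thesis by (metis mod_eq_dvd_iff dvdE)
    qed
    then obtain d where d: "\<And>l. l < N \<Longrightarrow> poly.coeff (r j) l - poly.coeff (r i) l = int p * d l" by metis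
    have "ceval (r j) x - ceval (r i) x = (\<Sum>l<N. of_int (poly.coeff (r j) l - poly.coeff (r i) l) * x ^ l)"
      unfolding ceval_upper[OF r(2)] by (simp add: sum_subtractf left_diff_distrib)
    also have "\<dots> = of_nat p * (\<Sum>l<N. of_int (d l) * x ^ l)"
      unfolding sum_distrib_left by (intro sum.cong) (auto simp: d simp del: of_int_diff)
    finally have diff: "ceval (r j) x - ceval (r i) x = of_nat p * (\<Sum>l<N. of_int (d l) * x ^ l)" .
    obtain y z where yz: "y \<in> V" "z \<in> V" "x ^ i = ceval (r i) x + of_nat p * y" "x ^ j = ceval (r j) x + of_nat p * z"
      using pow[OF x] by metis
    define w where "w = (\<Sum>l<N. of_int (d l) * x ^ l) + z - y"
    have wV: "w \<in> V" unfolding w_def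
      by (intro diff_mem add_mem sum_mem mult_mem of_int_mem power_mem yz xV x)
    have "x ^ j = x ^ i + of_nat p * w" using yz diff by (simp add: w_def algebra_simps)
    moreover have "x ^ j = x ^ i * x ^ (j - i)" using ij(1) by (simp flip: power_add)
    ultimately have "x ^ (j - i) = 1 + of_nat p * (w * inverse x ^ i)"
      using ixV[OF x] by (simp add: field_simps)
    moreover have "w * inverse x ^ i \<in> V" using ixV[OF x] wV by (intro mult_mem power_mem) auto
    ultimately show ?thesis unfolding one_units_def by blast
  qed
  then show ?thesis using ij xV by (intro exI[of _ "j - i"]) (auto simp: N_def)
qed

text \<open>Each of the e (p - 1) residue classes modulo \<open>E\<close> contains at most 2^(N+1) -
  1 orders, by \<open>exponential_sum_zeros\<close>.\<close>

lemma card_unit_orders_le: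
  fixes V :: "complex set" and \<alpha> :: "nat \<Rightarrow> complex" and f :: "int poly"
  assumes "p_valuation_ring V p" "p > 2"
    and f: "\<And>z. ceval f z = of_int c * z ^ d * (\<Prod>i<N. z - \<alpha> i)"
    and c: "\<not> int p dvd c"
    and e: "e > 0" "\<And>i. i < N \<Longrightarrow> \<alpha> i \<in> V" "\<And>i. i < N \<Longrightarrow> \<alpha> i ^ e \<in> p_valuation_ring.one_units V p"
    and not_generic: "\<not> defines_generic_units f"
  defines "M \<equiv> {m. m > 0 \<and> defines_unit_on_order f m}"
  shows "finite M \<and> card M \<le> e * (p - 1) * (2 ^ Suc N - 1)"
proof -
  interpret p_valuation_ring V p by fact
  define E where "E = e * (p - 1)"
  have E0: "E > 0" using e(1) \<open>p > 2\<close> by (simp add: E_def)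
  define v where "v = (\<lambda>m. of_int c ^ m * (\<Prod>i<N. \<alpha> i ^ m - 1))"
  have unit: "defines_unit_on_order f m \<longleftrightarrow> v m = 1 \<or> v m = - 1" if "m > 0" for m
    using defines_unit_iff_roots[OF that f] by (simp add: v_def)
  \<comment> \<open>Expanding the product over subsets \<open>S\<close> gives the bases
    \<open>b S\<close> with coefficients \<open>k r S\<close>. As \<open>E\<close> is a multiple of
    both \<open>e\<close> and \<open>p - 1\<close>, each base is 1 modulo \<open>p\<close>.\<close>
  define b where "b = (\<lambda>S. of_int c ^ E * (\<Prod>i\<in>S. \<alpha> i ^ E))"
  have b: "b S \<in> one_units" if "S \<in> Pow {..<N}" for S
  proof -
    have "(of_int c ^ (p - 1)) ^ e \<in> one_units"
      by (intro one_units_power of_int_power_in_one_units c \<open>p > 2\<close>)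
    moreover have "(\<alpha> i ^ e) ^ (p - 1) \<in> one_units" if "i \<in> S" for i
      using e(3) that \<open>S \<in> Pow {..<N}\<close> by (intro one_units_power[of "\<alpha> i ^ e"]) auto
    ultimately show ?thesis unfolding b_def E_def power_mult[symmetric] mult.commute[of e]
      by (intro one_units_mult one_units_prod) (auto simp: mult.commute)
  qed
  define k where "k = (\<lambda>r S. of_int c ^ r * (\<Prod>i\<in>S. \<alpha> i ^ r) * (\<Prod>i\<in>{..<N} - S. - 1 :: complex))"
  have k: "k r S \<in> V" if "S \<in> Pow {..<N}" for r S
    unfolding k_def using that e(2)
    by (intro mult_mem prod_mem power_mem of_int_mem minus_mem one_mem) auto
  have v: "v (r + E * x) = (\<Sum>S\<in>Pow {..<N}. k r S * b S ^ x)" for r x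
  proof -
    have "v (r + E * x) = of_int c ^ (r + E * x) * (\<Prod>i<N. \<alpha> i ^ (r + E * x) + (- 1))"
      by (simp add: v_def)
    also have "\<dots> = (\<Sum>S\<in>Pow {..<N}. k r S * b S ^ x)"
      unfolding prod_add[OF finite_lessThan] sum_distrib_left
      by (intro sum.cong)
         (simp_all add: k_def b_def power_add power_mult power_mult_distrib prod.distrib mult_ac flip: prod_power_distrib)
    finally show ?thesis .
  qed
  have v_cong: "v (r + E * x) - v (r + E * y) \<in> nonunits" for r x y
  proof -
    have *: "v (r + E * x) - v r \<in> nonunits" for x
    proof -
      have "v (r + E * x) - v r = (\<Sum>S\<in>Pow {..<N}. (b S ^ x - 1) * k r S)"
        using v[of r x] v[of r 0] by (simp add: algebra_simps sum_subtractf)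
      also have "\<dots> \<in> nonunits"
        by (intro nonunits_sum nonunits_mult one_units_diff_1 one_units_power b k)
      finally show ?thesis .
    qed
    show ?thesis using nonunits_add[OF *[of x] nonunits_minus[OF *[of y]]] by simp
  qed
  define X where "X = (\<lambda>r. {x. r + E * x \<in> M})"
  have X: "finite (X r) \<and> card (X r) \<le> 2 ^ Suc N - 1" for r
  proof (rule finite_if_finite_subsets_card_bdd)
    fix Y assume Y: "Y \<subseteq> X r" "finite Y"
    show "card Y \<le> 2 ^ Suc N - 1"
    proof (cases "Y = {}")
      case False
      then obtain y0 where "y0 \<in> Y" by blast
      have sign: "v (r + E * y) = 1 \<or> v (r + E * y) = - 1" if "y \<in> Y" for y
        using that Y(1) unit by (auto simp: X_def M_def)
      define \<sigma> where "\<sigma> = v (r + E * y0)"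
      have \<sigma>: "\<sigma> = 1 \<or> \<sigma> = - 1" using sign[OF \<open>y0 \<in> Y\<close>] by (simp add: \<sigma>_def)
      \<comment> \<open>Two different signs differ by 2 or -2, which is not in the maximal ideal as
        p > 2, while values in one class agree modulo that ideal.\<close>
      have \<sigma>_eq: "v (r + E * y) = \<sigma>" if "y \<in> Y" for y
      proof (rule ccontr)
        assume "v (r + E * y) \<noteq> \<sigma>"
        then have "v (r + E * y) - \<sigma> = of_int 2 \<or> v (r + E * y) - \<sigma> = of_int (- 2)"
          using sign[OF that] \<sigma> by auto
        then have "int p dvd 2 \<or> int p dvd - 2"
          using v_cong[of r y y0, folded \<sigma>_def] int_in_nonunits by metis
        then have "int p \<le> 2" using zdvd_imp_le[of "int p" 2] by auto
        then show False using \<open>p > 2\<close> by simp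
      qed
      \<comment> \<open>The index \<open>None\<close> carries the constant term -\<sigma> with base
        1.\<close>
      define I where "I = insert None (Some ` Pow {..<N})"
      have I: "finite I" "card I = 2 ^ N + 1"
        by (simp_all add: I_def card_image card_Pow)
      define \<kappa> where "\<kappa> = case_option (- \<sigma>) (k r)"
      define \<delta> where "\<delta> = case_option 0 (\<lambda>S. (b S - 1) / of_nat p)"
      have p0: "of_nat p \<noteq> (0::complex)" using \<open>p > 2\<close> by simp
      have "card Y < 2 * (card I - 1)"
      proof (rule exponential_sum_zeros[where h = "\<lambda>x. v (r + E * x) - \<sigma>" and \<kappa> = \<kappa> and \<delta> = \<delta>])
        show "card I \<ge> 2" using I by simp
        show "\<delta> i \<in> V" if "i \<in> I" for i
        proof (cases i)
          case (Some S)
          then have "b S \<in> one_units" using that by (intro b) (auto simp: I_def)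
          then show ?thesis using Some p0 by (auto simp: \<delta>_def one_units_def)
        qed (simp add: \<delta>_def zero_mem)
        show "v (r + E * x) - \<sigma> = (\<Sum>i\<in>I. \<kappa> i * (1 + of_nat p * \<delta> i) ^ x)" for x
          unfolding I_def v using p0
          by (simp add: sum.reindex \<kappa>_def \<delta>_def)
        show "\<exists>x. v (r + E * x) - \<sigma> \<noteq> 0"
        proof (rule ccontr)
          assume "\<not> (\<exists>x. v (r + E * x) - \<sigma> \<noteq> 0)"
          then have all: "v (r + E * x) = \<sigma>" for x by simp
          \<comment> \<open>Every \<open>m\<close> coprime to \<open>E\<close> divides a positive
            member of the class, on which \<open>f\<close> defines a unit.\<close>
          have "defines_unit_on_order f m" if m: "m > 0" "coprime m E" for m
          proof -
            have "coprime E m" using m by (simp add: coprime_commute)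
            then obtain y where y: "[E * y = 1] (mod m)" using cong_solve_coprime_nat[of E m] by auto
            \<comment> \<open>Here (m - 1) r stands for -r modulo \<open>m\<close>, so that E x is
              -r modulo \<open>m\<close>; the summand \<open>m\<close> keeps r + E x positive when r
              = 0.\<close>
            define x where "x = y * ((m - 1) * r) + m"
            have "[r + E * x = r + (E * y * ((m - 1) * r) + E * m)] (mod m)"
              by (simp add: x_def algebra_simps)
            also have "[r + (E * y * ((m - 1) * r) + E * m) = r + (1 * ((m - 1) * r) + 0)] (mod m)"
              by (intro cong_add cong_mult y cong_refl) (simp add: cong_0_iff)
            also have "r + (1 * ((m - 1) * r) + 0) = m * r"
              using m(1) by (cases m) auto
            finally have "m dvd r + E * x" by (metis cong_dvd_iff dvd_triv_left)
            moreover have "r + E * x > 0" using E0 m(1) by (simp add: x_def)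
            moreover have "defines_unit_on_order f (r + E * x)"
              using unit[OF calculation(2)] all[of x] \<sigma> by simp
            ultimately show ?thesis by (intro defines_unit_on_divisor[of f "r + E * x" m])
          qed
          then show False using not_generic E0 unfolding defines_generic_units_def by blast
        qed
        show "v (r + E * x) - \<sigma> = 0" if "x \<in> Y" for x using \<sigma>_eq[OF that] by simp
      qed (use I Y \<open>p > 2\<close> in auto)
      then show ?thesis using I(2) by simp
    qed simp
  qed
  have "M \<subseteq> (\<Union>r<E. (\<lambda>x. r + E * x) ` X r)"
  proof
    fix m assume "m \<in> M"
    then have "m = m mod E + E * (m div E)" "m div E \<in> X (m mod E)" by (simp_all add: X_def)
    moreover have "m mod E < E" using E0 by simp
    ultimately show "m \<in> (\<Union>r<E. (\<lambda>x. r + E * x) ` X r)" by blast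
  qed
  moreover have fin: "finite (\<Union>r<E. (\<lambda>x. r + E * x) ` X r)" using X by auto
  ultimately have "card M \<le> card (\<Union>r<E. (\<lambda>x. r + E * x) ` X r)" by (intro card_mono)
  also have "\<dots> \<le> (\<Sum>r<E. card ((\<lambda>x. r + E * x) ` X r))" by (rule card_UN_le) simp
  also have "\<dots> \<le> (\<Sum>r<E. 2 ^ Suc N - 1)"
    by (intro sum_mono order_trans[OF card_image_le]) (use X in auto)
  also have "\<dots> = e * (p - 1) * (2 ^ Suc N - 1)" by (simp add: E_def)
  finally show ?thesis using fin \<open>M \<subseteq> _\<close> finite_subset by blast
qed

text \<open>Erdos' proof that there are many primes: a natural number is determined by its square part
  and the set of primes occurring with odd multiplicity.\<close>

lemma prime_outside_le:
  fixes P :: "nat set"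
  assumes "finite P" "card P \<le> K" "K > 0"
  shows "\<exists>p. prime p \<and> p \<notin> P \<and> p \<le> 4 ^ K"
proof (rule ccontr)
  assume "\<not> ?thesis"
  then have P: "p \<in> P" if "prime p" "p \<le> 4 ^ K" for p using that by blast
  define F where "F = (\<lambda>n. ({p \<in> P. odd (multiplicity p n)}, square_part n :: nat))"
  have sq_le: "square_part n \<le> 2 ^ K \<and> square_part n \<ge> 1" if "n \<in> {1..4 ^ K}" for n :: nat
  proof -
    have "(square_part n)\<^sup>2 \<le> n" using that by (intro dvd_imp_le square_part_square_dvd) auto
    also have "\<dots> \<le> (2 ^ K)\<^sup>2" using that by (simp add: power2_eq_square flip: power_mult_distrib)
    finally have "square_part n \<le> 2 ^ K" by (simp add: power2_le_iff_abs_le)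
    moreover have "square_part n \<noteq> 0" using that by simp
    ultimately show ?thesis by linarith
  qed
  have "inj_on F {1..4 ^ K}"
  proof (rule inj_onI)
    fix m n assume mn: "m \<in> {1..4 ^ K}" "n \<in> {1..4 ^ K}" "F m = F n"
    have "multiplicity p m = multiplicity p n" if p: "prime p" for p
    proof -
      have out: "multiplicity p l = 0" if "l \<in> {1..4 ^ K}" "p \<notin> P" for l
      proof (rule not_dvd_imp_multiplicity_0)
        show "\<not> p dvd l"
        proof
          assume "p dvd l"
          then have "p \<le> l" using that(1) by (intro dvd_imp_le) auto
          then show False using P[OF p] that by simp
        qed
      qed
      have "multiplicity p m div 2 = multiplicity p n div 2"
        using mn(3) unfolding F_def prime_multiplicity_square_part[OF p, symmetric] by simp
      moreover have "odd (multiplicity p m) \<longleftrightarrow> odd (multiplicity p n)" if "p \<in> P"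
        using mn(3) that by (auto simp: F_def set_eq_iff)
      moreover have "a = b" if "a div 2 = b div 2" "odd a \<longleftrightarrow> odd b" for a b :: nat
        using that by presburger
      ultimately show ?thesis using out mn(1,2) by (cases "p \<in> P") metis+
    qed
    moreover have "m > 0" "n > 0" using mn(1,2) by auto
    ultimately show "m = n" using multiplicity_eq_nat by blast
  qed
  then have "4 ^ K = card (F ` {1..4 ^ K})" by (simp add: card_image)
  also have "\<dots> < card (Pow P \<times> {1..2 ^ K :: nat})"
  proof (rule psubset_card_mono)
    \<comment> \<open>Counting pairs alone gives only 4^K \<le> 4^K. One pair is never attained: it
      would force n = 4^K, in which 2 has even multiplicity although 2 lies in
      \<open>P\<close>.\<close>
    have "(P, 2 ^ K) \<notin> F ` {1..4 ^ K}"
    proof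
      assume "(P, 2 ^ K) \<in> F ` {1..4 ^ K}"
      then obtain n where n: "n \<in> {1..4 ^ K}" "square_part n = 2 ^ K" "P = {p \<in> P. odd (multiplicity p n)}"
        by (auto simp: F_def)
      have "(2 ^ K)\<^sup>2 dvd n" using square_part_square_dvd[of n] n(2) by simp
      then have "4 ^ K dvd n" by (simp add: power2_eq_square flip: power_mult_distrib)
      then have "4 ^ K \<le> n" using n(1) by (intro dvd_imp_le) auto
      then have "n = 2 ^ (2 * K)" using n(1) unfolding power_mult by simp
      then have "even (multiplicity 2 n)" by simp
      moreover have "2 \<in> P" using self_le_power[of "4 :: nat" K] \<open>K > 0\<close> by (intro P) auto
      ultimately show False using n(3) by blast
    qed
    moreover have "F ` {1..4 ^ K} \<subseteq> Pow P \<times> {1..2 ^ K}" using sq_le by (auto simp: F_def)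
    ultimately show "F ` {1..4 ^ K} \<subset> Pow P \<times> {1..2 ^ K}" by auto
  qed (use assms in auto)
  also have "\<dots> = 2 ^ card P * 2 ^ K" using assms by (simp add: card_cartesian_product card_Pow)
  also have "\<dots> \<le> 2 ^ K * 2 ^ K" using assms by simp
  also have "\<dots> = 4 ^ K" by (simp flip: power_mult_distrib)
  finally show False by simp
qed

lemma bound_arith:
  fixes p N k :: nat
  assumes "N > 0" "p \<le> 4 ^ Suc k" "k = 0 \<Longrightarrow> p = 3"
  shows "p ^ N * (p - 1) * (2 ^ Suc N - 1) \<le> 3 * 7 ^ (N * (1 + 2 * k))"
proof -
  obtain N' where N: "N = Suc N'" using assms(1) gr0_implies_Suc by blast
  show ?thesis
  proof (cases "k = 0")
    case True
    \<comment> \<open>The exponent starts at 2, since 24 > 21 at exponent 1; for N = 1 the exact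
      value 18 is used instead.\<close>
    have "4 * 6 ^ Suc (Suc l) \<le> 3 * (7::nat) ^ Suc (Suc l)" for l
      by (induction l) simp_all
    then have "4 * 6 ^ N \<le> 3 * (7::nat) ^ N" if "N \<noteq> 1" using that N by (cases N') auto
    moreover have "3 ^ N * 2 * (2 ^ Suc N - 1) \<le> 4 * (6::nat) ^ N"
    proof -
      have "(3::nat) ^ N * 2 * (2 ^ Suc N - 1) \<le> 3 ^ N * 2 * 2 ^ Suc N" by simp
      also have "\<dots> = 4 * 6 ^ N" by (simp flip: power_mult_distrib)
      finally show ?thesis .
    qed
    ultimately show ?thesis using assms(3) True by (cases "N = 1") auto
  next
    case False
    then obtain l where k: "k = Suc l" using not0_implies_Suc by blast
    have 1: "2 * p \<le> 7 * 49 ^ k"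
    proof -
      have "2 * 4 ^ Suc k \<le> 7 * (49::nat) ^ k" unfolding k by (induction l) simp_all
      then show ?thesis using assms(2) by linarith
    qed
    \<comment> \<open>The left side of the claim is at most (2p)^(N+1), one factor more than the N
      factors 7^(1+2k) on the right; this inequality absorbs it into the 3. At k = 1 it is as tight
      as 1024 \<le> 1029.\<close>
    have 2: "(2 * p) * (2 * p) \<le> 3 * (7 * 49 ^ k)"
    proof -
      have "(2 * p) * (2 * p) \<le> (2 * 4 ^ Suc k) * (2 * 4 ^ Suc k)" using assms(2) by (intro mult_le_mono) auto
      also have "\<dots> = 64 * 16 ^ k" by (simp flip: power_mult_distrib)
      also have "\<dots> \<le> 3 * (7 * (49::nat) ^ k)" unfolding k by (induction l) simp_all
      finally show ?thesis .
    qed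
    have "p ^ N * (p - 1) * (2 ^ Suc N - 1) \<le> p ^ N * p * 2 ^ Suc N" by (intro mult_le_mono) auto
    also have "\<dots> = (2 * p) * (2 * p) * (2 * p) ^ N'" by (simp add: N power_mult_distrib)
    also have "\<dots> \<le> 3 * (7 * 49 ^ k) * (7 * 49 ^ k) ^ N'" by (intro mult_le_mono 2 power_mono 1) simp
    also have "\<dots> = 3 * (7 * 49 ^ k) ^ N" by (simp add: N)
    also have "(7 * 49 ^ k) = (7::nat) ^ (1 + 2 * k)" by (simp add: power_mult)
    also have "((7::nat) ^ (1 + 2 * k)) ^ N = 7 ^ (N * (1 + 2 * k))" by (simp only: power_mult[symmetric] mult.commute)
    finally show ?thesis .
  qed
qed

text \<open>Besides the prime divisors of \<open>a\<close>, the prime 2 is excluded, hence the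
  exponent \<open>Suc k\<close>. For k = 0 the prime 3 is available.\<close>

lemma exists_small_odd_prime:
  fixes a :: int
  assumes "a \<noteq> 0" and k: "k = card {p::nat. prime p \<and> int p dvd a}"
  shows "\<exists>p. prime p \<and> p > 2 \<and> \<not> int p dvd a \<and> p \<le> 4 ^ Suc k \<and> (k = 0 \<longrightarrow> p = 3)"
proof -
  define P where "P = {p::nat. prime p \<and> int p dvd a}"
  have "P \<subseteq> {..nat \<bar>a\<bar>}" using assms(1) by (auto simp: P_def dest!: dvd_imp_le_int)
  then have fin: "finite P" by (rule finite_subset) simp
  show ?thesis
  proof (cases "k = 0")
    case True
    then have "P = {}" using k fin by (simp add: P_def)
    moreover have "prime (3::nat)" by simp
    ultimately have "\<not> int 3 dvd a" unfolding P_def by blast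
    then show ?thesis using True \<open>prime 3\<close> by (intro exI[of _ 3]) simp
  next
    case False
    have "card (insert 2 P) \<le> Suc k" using k fin card_insert_le_m1 by (simp add: P_def card_insert_if)
    then obtain p where p: "prime p" "p \<notin> insert 2 P" "p \<le> 4 ^ Suc k"
      using prime_outside_le[of "insert 2 P" "Suc k"] fin by auto
    then have "p > 2" using prime_ge_2_nat[of p] by auto
    then show ?thesis using p False by (intro exI[of _ p]) (auto simp: P_def)
  qed
qed

text \<open>The fundamental theorem of algebra, with the multiset of roots listed as a sequence so
  that multiplicities are kept.\<close>

lemma ceval_factorization:
  assumes "P \<noteq> 0"
  obtains \<alpha> :: "nat \<Rightarrow> complex"
  where "\<And>z. ceval P z = of_int (lead_coeff P) * (\<Prod>i<degree P. z - \<alpha> i)"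
proof -
  define Q where "Q = map_poly complex_of_int P"
  have deg: "degree Q = degree P" unfolding Q_def by (rule degree_map_poly) simp
  then have "lead_coeff Q = of_int (lead_coeff P)" by (simp add: Q_def coeff_map_poly)
  moreover from this have "Q \<noteq> 0" using assms by auto
  ultimately obtain A where A: "size A = degree P"
    "Q = Polynomial.smult (of_int (lead_coeff P)) (\<Prod>x\<in>#A. [:- x, 1:])"
    using alg_closed_imp_factorization[of Q] deg by auto
  obtain xs where xs: "mset xs = A" using ex_mset by blast
  have "poly Q z = of_int (lead_coeff P) * (\<Prod>i<degree P. z - xs ! i)" for z
  proof -
    have "poly Q z = of_int (lead_coeff P) * (\<Prod>x\<in>#A. z - x)"
      unfolding A(2) by (simp add: poly_prod_mset image_mset.compositionality o_def)
    also have "(\<Prod>x\<in>#A. z - x) = prod_list (map (\<lambda>x. z - x) xs)"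
      by (simp flip: xs prod_mset_prod_list)
    also have "\<dots> = (\<Prod>i<degree P. z - xs ! i)"
    proof -
      have "length xs = degree P" using A(1) xs by auto
      then show ?thesis
        unfolding prod.list_conv_set_nth by (intro prod.cong) auto
    qed
    finally show ?thesis .
  qed
  then show ?thesis using that unfolding Q_def by blast
qed

theorem corollary0p8:
  fixes f :: "int poly" and c :: "nat \<Rightarrow> int" and d n k :: nat and M :: "nat set"
  assumes "f = (\<Sum>i = d..n. Polynomial.monom (c i) i)"
    and "d \<le> n"
    and "c d * c n \<noteq> 0"
    and "k = card {p::nat. prime p \<and> int p dvd c d * c n}"
    and "M = {m::nat. m > 0 \<and> defines_unit_on_order f m}"
    and "\<not> defines_generic_units f"
  shows "finite M \<and> card M \<le> 3 * 7 ^ ((n - d) * (1 + 2 * k))"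
proof -
  define N where "N = n - d"
  \<comment> \<open>Splitting off X^d leaves a polynomial whose constant coefficient
    \<open>c d\<close> is nonzero, so that all its roots are nonzero.\<close>
  define P where "P = (\<Sum>i\<le>N. Polynomial.monom (c (i + d)) i)"
  have P_coeff: "poly.coeff P i = (if i \<le> N then c (i + d) else 0)" for i
    by (simp add: P_def coeff_sum)
  have cd: "c d \<noteq> 0" and cn: "c n \<noteq> 0" using assms(3) by auto
  have nN: "N + d = n" using assms(2) by (simp add: N_def)
  have deg: "degree P = N"
    using cn by (intro antisym degree_le le_degree) (auto simp: P_coeff nN)
  have lc: "lead_coeff P = c n" and c0: "poly.coeff P 0 = c d" by (simp_all add: deg P_coeff nN)
  have "f = Polynomial.monom 1 d * P"
  proof -
    have "f = (\<Sum>i=0+d..N+d. Polynomial.monom (c i) i)" by (simp add: assms(1) nN)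
    also have "\<dots> = (\<Sum>i=0..N. Polynomial.monom (c (i + d)) (i + d))" by (rule sum.shift_bounds_cl_nat_ivl)
    finally show ?thesis by (simp add: P_def sum_distrib_left mult_monom atLeast0AtMost add.commute)
  qed
  then have fP: "ceval f z = z ^ d * ceval P z" for z by (simp add: ceval_simps)
  have "P \<noteq> 0" using c0 cd by auto
  then obtain \<alpha> where \<alpha>: "\<And>z. ceval P z = of_int (c n) * (\<Prod>i<N. z - \<alpha> i)"
    using ceval_factorization unfolding lc[symmetric] deg[symmetric] by blast
  have f: "ceval f z = of_int (c n) * z ^ d * (\<Prod>i<N. z - \<alpha> i)" for z by (simp add: fP \<alpha>)
  show ?thesis
  proof (cases "N = 0")
    case True
    have unit: "defines_unit_on_order f m \<longleftrightarrow> c n ^ m \<in> {1, - 1}" if "m > 0" for m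
    proof -
      have "defines_unit_on_order f m \<longleftrightarrow> complex_of_int (c n ^ m) \<in> {of_int 1, of_int (- 1)}"
        using defines_unit_iff_roots[OF that f] True by simp
      then show ?thesis unfolding insert_iff of_int_eq_iff by simp
    qed
    \<comment> \<open>For a monomial, a unit on a single order forces \<open>c n\<close> to be 1 or
      -1, and then every order gives a unit.\<close>
    have "M = {}"
    proof (rule ccontr)
      assume "M \<noteq> {}"
      then obtain m where "m > 0" "c n ^ m \<in> {1, - 1}" using assms(5) unit by blast
      then have "\<bar>c n\<bar> ^ m = 1" by (auto simp flip: power_abs)
      then have "\<bar>c n\<bar> = 1" using \<open>m > 0\<close> by (intro power_eq_imp_eq_base[of "\<bar>c n\<bar>" m 1]) auto
      then have "c n = 1 \<or> c n = - 1" by linarith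
      then have "c n ^ l \<in> {1, - 1}" for l by (cases "even l") auto
      then have "defines_generic_units f" unfolding defines_generic_units_def
        using unit by (intro exI[of _ 1]) auto
      then show False using assms(6) by contradiction
    qed
    then show ?thesis by simp
  next
    case False
    \<comment> \<open>As \<open>p\<close> divides neither \<open>c d\<close> nor \<open>c n\<close>,
      the roots of \<open>P\<close> are units of every valuation ring above
      \<open>p\<close>.\<close>
    obtain p where p: "prime p" "p > 2" "\<not> int p dvd c d * c n" "p \<le> 4 ^ Suc k" "k = 0 \<longrightarrow> p = 3"
      using exists_small_odd_prime[OF assms(3,4)] by blast
    then have pc: "\<not> int p dvd c d" "\<not> int p dvd c n" by auto
    obtain V :: "complex set" where V: "p_valuation_ring V p" using p_valuation_ring_exists[OF p(1)] by blast
    obtain e where e: "0 < e" "e \<le> p ^ N"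
      "\<And>x. ceval P x = 0 \<Longrightarrow> x \<in> V \<and> x ^ e \<in> p_valuation_ring.one_units V p"
      using roots_one_units_exponent[OF V pc(2)[folded lc] pc(1)[folded c0]] unfolding deg by blast
    have root: "ceval P (\<alpha> i) = 0" if "i < N" for i using that by (auto simp: \<alpha>)
    have "finite M \<and> card M \<le> e * (p - 1) * (2 ^ Suc N - 1)"
      unfolding assms(5) using e root assms(6)
      by (intro card_unit_orders_le[OF V p(2) f pc(2)]) auto
    moreover have "e * (p - 1) * (2 ^ Suc N - 1) \<le> p ^ N * (p - 1) * (2 ^ Suc N - 1)"
      using e(2) by (intro mult_le_mono) auto
    moreover have "\<dots> \<le> 3 * 7 ^ (N * (1 + 2 * k))"
      using False p by (intro bound_arith) auto
    ultimately show ?thesis unfolding N_def by linarith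
  qed
qed

end
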